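(* Let $\mathcal{C}$ be a deterministic time-complexity class with $\mathcal{C}\subseteq\mathrm{SubExp}$. Let $G$ be a finitely presented group and let $H\le G$ be a subgroup such that the membership problem for $H$ in $G$ is in $\mathrm{SubExp}$. Let $G_1\le G$ be a subgroup of finite index in $G$ such that $H\le G_1$, and let $\phi:G_1\to\bar G$ be an epimorphism onto a group $\bar G$. Suppose there is a subgroup $K$ with $\phi(H)\le K\le\bar G$ such that the Schreier coset graph for $\bar G$ over $K$ is non-amenable and such that the membership problem for $K$ in $\bar G$ is solvable in the complexity class $\mathcal{C}$. Then for any finite generating set $A$ of $G$ the membership problem $MP(G,H,A)$ for $H$ in $G$ is solvable with average-case time-complexity in $\mathcal{C}$ uniformly relative to the family of all length-invariant discrete probability measures $\mu:(A\cup A^{-1})^*\to[0,1]$.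
   Context: Membership problem: a finite generating set of a group $G$ is a finite alphabet $A$ with a map $\pi: A\to G$ whose image generates $G$ (different letters may represent the same element, and letters may represent $1$). Put $X=A\cup A^{-1}$, where $A^{-1}$ is the set of formal inverses, and let $X^*$ be the set of all (not necessarily freely reduced) words in $X$. For $H\le G$, $MP(G,H,A)\subseteq X^*$ is the set of words representing elements of $H$. Its worst-case complexity does not depend on the choice of finite generating set, so one speaks of the membership problem for $H$ in $G$. Schreier graphs: for a group $G$ with finite generating set $A$ and $H\le G$, the Schreier coset graph $\Gamma(G,H,A)$ has vertex set $\{Hg: g\in G\}$ and, for each coset $Hg$ and each $a\in A$, an edge labeled $a$ from $Hg$ to $Hga$, together with its formal inverse edge from $Hga$ to $Hg$ labeled $a^{-1}$. It is connected and $2|A|$-regular. A connected regular graph (loops and multiple edges allowed) is non-amenable if there is $\epsilon>0$ such that every finite nonempty set $S$ of vertices has at least $\epsilon|S|$ edges joining $S$ to its complement. For Schreier graphs, whether this holds does not depend on the choice of finite generating set. Complexity: an algorithm is a deterministic multi-tape Turing machine. Only deterministic time-complexity classes are considered. It is assumed that the collection of functions bounding the computation time in a class $\mathcal{C}$ consists of proper complexity functions $f(n)\ge n$, and that for each $f$ in the collection and each integer $C\ge 1$ the function $Cf(Cn+C)+C$ is also in the collection. A non-negative function $f(n)$ is subexponential if $\lim_{n\to\infty} f(n)/r^n=0$ for every $r>1$. $\mathrm{SubExp}$ is the class of languages decidable in deterministic subexponential time. Measures: for a finite alphabet $X$ with $|X|\ge 2$, a discrete probability measure on $X^*$ is a function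 $\mu:X^*\to[0,1]$ with $\sum_{w\in X^*}\mu(w)=1$; it is length-invariant if $\mu(w)=\mu(w')$ whenever $|w|=|w'|$. Average-case complexity: let $\mathcal{D}\subseteq X^*$ and let $M$ be an algorithm that decides, for every $w\in X^*$, whether $w\in\mathcal{D}$, in time $T(w)<\infty$. Let $f(n)$ be a non-decreasing positive function and let $\mathfrak{R}$ be a family of discrete probability measures on $X^*$. $M$ solves $\mathcal{D}$ with average-case time-complexity bounded by $f(n)$ uniformly relative to $\mathfrak{R}$ if there is $0<C<\infty$ such that for every $\mu\in\mathfrak{R}$, $$\sum_{w\in X^*}\frac{T(w)}{f(|w|)}\mu(w)\le C.$$ If such an $f$ satisfies the bound constraint of a time-complexity class $\mathcal{C}$, then $M$ solves $\mathcal{D}$ with average-case time-complexity in $\mathcal{C}$ uniformly relative to $\mathfrak{R}$. $\mathcal{D}$ is solvable with this average-case complexity if some such $M$ exists. *)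

theory Defs
  imports
    "HOL-Analysis.Infinite_Sum"
    "HOL-Algebra.Generated_Groups"
    "Graph_Theory.Digraph"
begin

section \<open>Deterministic multi-tape Turing machines\<close>

text \<open>
  The input letters are themselves tape symbols. The auxiliary symbols and the states are drawn
  from the natural numbers, and each machine uses only finitely many of them. Tapes are infinite
  in both directions; a tape is stored together with the position of its head.
\<close>

datatype 'a symbol = Blank | Letter 'a | Mark nat

datatype direction = MoveL | Stay | MoveR

record 'a machine =
  num_tapes :: nat
  states :: "nat set"
  marks :: "nat set"
  start :: nat
  accept :: nat
  reject :: nat
  delta :: "nat \<Rightarrow> 'a symbol list \<Rightarrow> nat \<times> ('a symbol \<times> direction) list"

type_synonym 'a tape = "(int \<Rightarrow> 'a symbol) \<times> int"

type_synonym 'a configuration = "nat \<times> 'a tape list"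

definition tape_symbols :: "'a set \<Rightarrow> 'a machine \<Rightarrow> 'a symbol set" where
  "tape_symbols \<Sigma> M = {Blank} \<union> Letter ` \<Sigma> \<union> Mark ` marks M"

definition halting :: "'a machine \<Rightarrow> nat set" where
  "halting M = {accept M, reject M}"

definition turing_machine :: "'a set \<Rightarrow> 'a machine \<Rightarrow> bool" where
  "turing_machine \<Sigma> M \<longleftrightarrow>
     finite \<Sigma> \<and> 1 \<le> num_tapes M \<and> finite (states M) \<and> finite (marks M) \<and>
     start M \<in> states M \<and> halting M \<subseteq> states M \<and> accept M \<noteq> reject M \<and>
     (\<forall>q \<in> states M - halting M. \<forall>ss \<in> lists (tape_symbols \<Sigma> M). length ss = num_tapes M \<longrightarrow>
        fst (delta M q ss) \<in> states M \<and>
        length (snd (delta M q ss)) = num_tapes M \<and>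
        fst ` set (snd (delta M q ss)) \<subseteq> tape_symbols \<Sigma> M)"

fun move :: "direction \<Rightarrow> int \<Rightarrow> int" where
  "move MoveL h = h - 1"
| "move Stay h = h"
| "move MoveR h = h + 1"

fun act :: "'a tape \<Rightarrow> 'a symbol \<times> direction \<Rightarrow> 'a tape" where
  "act (t, h) (s, d) = (t(h := s), move d h)"

definition step :: "'a machine \<Rightarrow> 'a configuration \<Rightarrow> 'a configuration" where
  "step M c =
     (if fst c \<in> halting M then c
      else let r = delta M (fst c) (map (\<lambda>(t, h). t h) (snd c))
           in (fst r, map2 act (snd c) (snd r)))"

definition tape_of :: "'a symbol list \<Rightarrow> int \<Rightarrow> 'a symbol" where
  "tape_of ss i = (if 0 \<le> i \<and> i < int (length ss) then ss ! nat i else Blank)"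

definition initial :: "'a machine \<Rightarrow> 'a list \<Rightarrow> 'a configuration" where
  "initial M w =
     (start M, (tape_of (map Letter w), 0) # replicate (num_tapes M - 1) (\<lambda>_. Blank, 0))"

definition run :: "'a machine \<Rightarrow> 'a list \<Rightarrow> nat \<Rightarrow> 'a configuration" where
  "run M w t = (step M ^^ t) (initial M w)"

definition halts :: "'a machine \<Rightarrow> 'a list \<Rightarrow> bool" where
  "halts M w \<longleftrightarrow> (\<exists>t. fst (run M w t) \<in> halting M)"

text \<open>The number of steps is meaningful only if the machine halts on the given input.\<close>

definition run_time :: "'a machine \<Rightarrow> 'a list \<Rightarrow> nat" where
  "run_time M w = (LEAST t. fst (run M w t) \<in> halting M)"

definition final :: "'a machine \<Rightarrow> 'a list \<Rightarrow> 'a configuration" where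
  "final M w = run M w (run_time M w)"

definition decides :: "'a machine \<Rightarrow> 'a set \<Rightarrow> 'a list set \<Rightarrow> bool" where
  "decides M \<Sigma> L \<longleftrightarrow> turing_machine \<Sigma> M \<and>
     (\<forall>w \<in> lists \<Sigma>. halts M w \<and> (fst (final M w) = accept M \<longleftrightarrow> w \<in> L))"


section \<open>Time-complexity classes\<close>

text \<open>
  A decision problem is a pair of a finite alphabet and a language over it; a complexity class is
  a set of decision problems. The set \<open>F\<close> is the collection of functions that bound the
  computation time in the class.
\<close>

type_synonym 'a problem = "'a set \<times> 'a list set"

definition time_class :: "(nat \<Rightarrow> nat) set \<Rightarrow> 'a problem set" where
  "time_class F = {(\<Sigma>, L). finite \<Sigma> \<and> L \<subseteq> lists \<Sigma> \<and>
     (\<exists>M. \<exists>f \<in> F. decides M \<Sigma> L \<and> (\<forall>w \<in> lists \<Sigma>. run_time M w \<le> f (length w)))}"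

text \<open>
  Running times are natural numbers, so replacing a non-negative real bound by its floor shows that
  nothing is lost by considering only bounds with values in the natural numbers.
\<close>

definition subexponential :: "(nat \<Rightarrow> nat) \<Rightarrow> bool" where
  "subexponential f \<longleftrightarrow> (\<forall>r::real. r > 1 \<longrightarrow> (\<lambda>n. real (f n) / r ^ n) \<longlonglongrightarrow> 0)"

definition SubExp :: "'a problem set" where
  "SubExp = time_class {f. subexponential f}"

text \<open>
  Proper complexity functions in the sense of Papadimitriou: \<open>f\<close> is non-decreasing, and some
  machine with a read-only input tape prints a string of exactly \<open>f n\<close> copies of a fixed non-blank
  symbol on its last tape on every input of length \<open>n\<close>, in time \<open>O(n + f n)\<close> and in space
  \<open>O(f n)\<close> besides its input. Since only the length of the input matters, the input
  alphabet has one letter.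
\<close>

definition work_space :: "'a machine \<Rightarrow> 'a list \<Rightarrow> nat" where
  "work_space M w =
     (\<Sum>i = 1..<num_tapes M. card ((\<lambda>t. snd (snd (run M w t) ! i)) ` {..run_time M w}))"

definition read_only_input :: "'a machine \<Rightarrow> 'a list \<Rightarrow> bool" where
  "read_only_input M w \<longleftrightarrow>
     (\<forall>t. fst (snd (run M w t) ! 0) = tape_of (map Letter w) \<and>
          snd (snd (run M w t) ! 0) \<in> {- 1..int (length w)})"

definition proper_complexity_function :: "(nat \<Rightarrow> nat) \<Rightarrow> bool" where
  "proper_complexity_function f \<longleftrightarrow> mono f \<and>
     (\<exists>(M :: unit machine) s c.
        turing_machine UNIV M \<and> 2 \<le> num_tapes M \<and> s \<noteq> Blank \<and>
        (\<forall>w. halts M w \<and> read_only_input M w \<and>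
             fst (last (snd (final M w))) = tape_of (replicate (f (length w)) s) \<and>
             run_time M w \<le> c * (length w + f (length w)) + c \<and>
             work_space M w \<le> c * f (length w) + c))"

definition time_bounds :: "(nat \<Rightarrow> nat) set \<Rightarrow> bool" where
  "time_bounds F \<longleftrightarrow>
     (\<forall>f \<in> F. proper_complexity_function f \<and> (\<forall>n. n \<le> f n) \<and>
        (\<forall>C \<ge> 1. (\<lambda>n. C * f (C * n + C) + C) \<in> F))"


section \<open>Average-case complexity\<close>

definition discrete_probability_measure :: "'a set \<Rightarrow> ('a list \<Rightarrow> real) \<Rightarrow> bool" where
  "discrete_probability_measure X \<mu> \<longleftrightarrow>
     (\<forall>w \<in> lists X. 0 \<le> \<mu> w \<and> \<mu> w \<le> 1) \<and> (\<mu> has_sum 1) (lists X)"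

definition length_invariant :: "'a set \<Rightarrow> ('a list \<Rightarrow> real) \<Rightarrow> bool" where
  "length_invariant X \<mu> \<longleftrightarrow>
     (\<forall>w \<in> lists X. \<forall>w' \<in> lists X. length w = length w' \<longrightarrow> \<mu> w = \<mu> w')"

text \<open>Summability is required explicitly because the sum of a divergent family is 0 by convention.\<close>

definition solves_on_average ::
  "'a machine \<Rightarrow> 'a problem \<Rightarrow> (nat \<Rightarrow> real) \<Rightarrow> ('a list \<Rightarrow> real) set \<Rightarrow> bool" where
  "solves_on_average M P f \<RR> \<longleftrightarrow>
     decides M (fst P) (snd P) \<and> mono f \<and> (\<forall>n. 0 < f n) \<and>
     (\<exists>C > 0. \<forall>\<mu> \<in> \<RR>.
        (\<lambda>w. real (run_time M w) / f (length w) * \<mu> w) summable_on lists (fst P) \<and>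
        (\<Sum>\<^sub>\<infinity>w \<in> lists (fst P). real (run_time M w) / f (length w) * \<mu> w) \<le> C)"

definition solvable_on_average ::
  "'a problem \<Rightarrow> (nat \<Rightarrow> nat) set \<Rightarrow> ('a list \<Rightarrow> real) set \<Rightarrow> bool" where
  "solvable_on_average P F \<RR> \<longleftrightarrow> (\<exists>M. \<exists>f \<in> F. solves_on_average M P (\<lambda>n. real (f n)) \<RR>)"


section \<open>Words in generators and the membership problem\<close>

datatype 'a signed = Pos 'a | Neg 'a

definition signed_alphabet :: "'a set \<Rightarrow> 'a signed set" where
  "signed_alphabet A = Pos ` A \<union> Neg ` A"

fun formal_inverse :: "'a signed \<Rightarrow> 'a signed" where
  "formal_inverse (Pos a) = Neg a"
| "formal_inverse (Neg a) = Pos a"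

fun letter_value :: "('g, 'm) monoid_scheme \<Rightarrow> ('a \<Rightarrow> 'g) \<Rightarrow> 'a signed \<Rightarrow> 'g" where
  "letter_value G \<pi> (Pos a) = \<pi> a"
| "letter_value G \<pi> (Neg a) = inv\<^bsub>G\<^esub> (\<pi> a)"

definition word_value :: "('g, 'm) monoid_scheme \<Rightarrow> ('a \<Rightarrow> 'g) \<Rightarrow> 'a signed list \<Rightarrow> 'g" where
  "word_value G \<pi> w = foldr (\<lambda>x g. letter_value G \<pi> x \<otimes>\<^bsub>G\<^esub> g) w \<one>\<^bsub>G\<^esub>"

definition generating_alphabet :: "('g, 'm) monoid_scheme \<Rightarrow> 'a set \<Rightarrow> ('a \<Rightarrow> 'g) \<Rightarrow> bool" where
  "generating_alphabet G A \<pi> \<longleftrightarrow>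
     finite A \<and> \<pi> ` A \<subseteq> carrier G \<and> generate G (\<pi> ` A) = carrier G"

definition MP ::
  "('g, 'm) monoid_scheme \<Rightarrow> 'g set \<Rightarrow> 'a set \<Rightarrow> ('a \<Rightarrow> 'g) \<Rightarrow> 'a signed problem" where
  "MP G H A \<pi> =
     (signed_alphabet A, {w \<in> lists (signed_alphabet A). word_value G \<pi> w \<in> H})"

text \<open>
  Worst-case complexity does not depend on the finite generating set, so one generating set is
  required to exist; up to renaming of its letters, every finite alphabet is a set of natural numbers.
\<close>

definition membership_problem_in ::
  "('g, 'm) monoid_scheme \<Rightarrow> 'g set \<Rightarrow> nat signed problem set \<Rightarrow> bool" where
  "membership_problem_in G H \<C> \<longleftrightarrow>
     (\<exists>(A :: nat set) \<pi>. generating_alphabet G A \<pi> \<and> MP G H A \<pi> \<in> \<C>)"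


section \<open>Finitely presented groups\<close>

inductive_set presentation_equiv :: "'a set \<Rightarrow> 'a signed list set \<Rightarrow> 'a signed list rel"
  for A R where
  refl: "w \<in> lists (signed_alphabet A) \<Longrightarrow> (w, w) \<in> presentation_equiv A R"
| sym: "(u, v) \<in> presentation_equiv A R \<Longrightarrow> (v, u) \<in> presentation_equiv A R"
| trans: "(u, v) \<in> presentation_equiv A R \<Longrightarrow> (v, w) \<in> presentation_equiv A R \<Longrightarrow>
    (u, w) \<in> presentation_equiv A R"
| cancel: "u \<in> lists (signed_alphabet A) \<Longrightarrow> v \<in> lists (signed_alphabet A) \<Longrightarrow>
    x \<in> signed_alphabet A \<Longrightarrow>
    (u @ [x, formal_inverse x] @ v, u @ v) \<in> presentation_equiv A R"
| relator: "u \<in> lists (signed_alphabet A) \<Longrightarrow> v \<in> lists (signed_alphabet A) \<Longrightarrow> r \<in> R \<Longrightarrow>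
    (u @ r @ v, u @ v) \<in> presentation_equiv A R"

text \<open>The group presented by generators \<open>A\<close> and relators \<open>R \<subseteq> lists (signed_alphabet A)\<close>.\<close>

definition presented_group :: "'a set \<Rightarrow> 'a signed list set \<Rightarrow> 'a signed list set monoid" where
  "presented_group A R =
     \<lparr>carrier = lists (signed_alphabet A) // presentation_equiv A R,
      monoid.mult = (\<lambda>P Q. \<Union>u \<in> P. \<Union>v \<in> Q. presentation_equiv A R `` {u @ v}),
      one = presentation_equiv A R `` {[]}\<rparr>"

definition finitely_presented :: "('g, 'm) monoid_scheme \<Rightarrow> bool" where
  "finitely_presented G \<longleftrightarrow> group G \<and>
     (\<exists>(A :: nat set) R. finite A \<and> finite R \<and> R \<subseteq> lists (signed_alphabet A) \<and>
        G \<cong> presented_group A R)"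


section \<open>Schreier coset graphs and non-amenability\<close>

text \<open>
  The arc \<open>(v, Neg a)\<close> leads from \<open>v\<close> to \<open>v #> inv (\<pi> a)\<close>; it is the formal inverse of the arc
  \<open>(v #> inv (\<pi> a), Pos a)\<close>.
\<close>

definition schreier_graph ::
  "('g, 'm) monoid_scheme \<Rightarrow> 'g set \<Rightarrow> 'a set \<Rightarrow> ('a \<Rightarrow> 'g) \<Rightarrow>
    ('g set, 'g set \<times> 'a signed) pre_digraph" where
  "schreier_graph G H A \<pi> =
     \<lparr>verts = rcosets\<^bsub>G\<^esub> H,
      arcs = (rcosets\<^bsub>G\<^esub> H) \<times> signed_alphabet A,
      tail = fst,
      head = (\<lambda>(v, x). v #>\<^bsub>G\<^esub> letter_value G \<pi> x)\<rparr>"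

text \<open>
  For graphs in which every arc is paired with its formal inverse, an undirected edge between \<open>S\<close>
  and its complement is counted once, namely as its orientation that leaves \<open>S\<close>.
\<close>

definition non_amenable :: "('v, 'e) pre_digraph \<Rightarrow> bool" where
  "non_amenable \<Gamma> \<longleftrightarrow>
     (\<exists>\<epsilon>::real. \<epsilon> > 0 \<and>
        (\<forall>S. finite S \<and> S \<noteq> {} \<and> S \<subseteq> verts \<Gamma> \<longrightarrow>
           \<epsilon> * real (card S) \<le>
             real (card {e \<in> arcs \<Gamma>. tail \<Gamma> e \<in> S \<and> head \<Gamma> e \<in> verts \<Gamma> - S})))"

definition non_amenable_over :: "('g, 'm) monoid_scheme \<Rightarrow> 'g set \<Rightarrow> bool" where
  "non_amenable_over G H \<longleftrightarrow>
     (\<exists>(A :: nat set) \<pi>. generating_alphabet G A \<pi> \<and> non_amenable (schreier_graph G H A \<pi>))"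

end

theory Submission
  imports Defs "HOL-Library.Countable"
begin

text \<open>
  Let \<open>P = \<phi>\<^sup>-\<^sup>1(K)\<close>, so \<open>H \<subseteq> P \<subseteq> G1\<close>. A word is first tested for membership in \<open>P\<close>: a finite transducer
  tracks its coset modulo \<open>G1\<close> and rewrites it into a word over the generators of \<open>G'\<close>, on which the
  machine for \<open>K\<close> is run. Only if that machine accepts is the slow machine for \<open>H\<close> started. The
  Schreier graph of \<open>G\<close> over \<open>P\<close> inherits non-amenability, so Cheeger's inequality bounds the norm of
  its adjacency operator by some \<open>r < |X|\<close>, and at most \<open>r\<^sup>n\<close> words of length \<open>n\<close> lie in \<open>P\<close>. For a
  length-invariant measure these words are so rare that they absorb the subexponential cost of the
  second stage.
\<close>

section \<open>Runs of Turing machines\<close>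

text \<open>A word of length n in P is hit with relative frequency at most (r/|X|)^n, so the second
  machine may cost any s^n with s slightly above 1. The rewriting stretches words by a factor of at
  most b, which is why s is a root of |X|/r. Uniformity in the measure comes from comparing masses
  one length at a time. Two changes of setting shape the rest. The given machines work over their
  own alphabets and generators, so their symbols are coded by marks and the transducer writes an
  input for each of them. And expansion is known for cosets of K and generators of G', not for
  cosets of P and generators of G. The cosets of P fall into finitely many copies of the coset space
  of K, one for each coset of G1; on each copy a generator of G' is imitated by a fixed word over A,
  so one boundary edge below costs boundedly many above. The spectral part uses no Hilbert space:
  all sums run over finite windows that grow with each application of the operator.\<close>

lemma run_0 [simp]: "run M w 0 = initial M w"
  by (simp add: run_def)

lemma run_Suc: "run M w (Suc t) = step M (run M w t)"
  by (simp add: run_def)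

lemma step_halted: "fst c \<in> halting M \<Longrightarrow> (step M ^^ n) c = c"
  by (induction n) (auto simp: step_def)

lemma funpow_steps: "(f ^^ m) ((f ^^ n) c) = (f ^^ (n + m)) c"
  by (simp add: funpow_add add.commute[of n m])

text \<open>Halting configurations are fixed by \<open>step\<close>, so the outcome can be read off
  at any halting time; constructions need not exhibit the least one.\<close>

lemma run_halted:
  assumes "fst (run M w t) \<in> halting M"
  shows "halts M w" "run_time M w \<le> t" "final M w = run M w t"
proof -
  show "halts M w" using assms by (auto simp: halts_def)
  show le: "run_time M w \<le> t" unfolding run_time_def by (rule Least_le) (rule assms)
  have h: "fst (run M w (run_time M w)) \<in> halting M"
    unfolding run_time_def by (rule LeastI) (rule assms)
  have "run M w t = (step M ^^ (t - run_time M w)) (run M w (run_time M w))"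
    unfolding run_def funpow_steps using le by simp
  then show "final M w = run M w t" using step_halted[OF h] by (simp add: final_def)
qed

lemma halts_run_time: "halts M w \<Longrightarrow> fst (run M w (run_time M w)) \<in> halting M"
  unfolding halts_def run_time_def by (erule exE) (rule LeastI)

definition read :: "'a tape \<Rightarrow> 'a symbol" where
  "read T = fst T (snd T)"

lemma act_eq: "act T p = ((fst T)(snd T := fst p), move (snd p) (snd T))"
  by (cases T; cases p) simp

lemma step_not_halted:
  assumes "q \<notin> halting M"
  shows "step M (q, Ts) =
    (fst (delta M q (map read Ts)), map2 act Ts (snd (delta M q (map read Ts))))"
proof -
  have "(\<lambda>(t, h). t h) = (read :: 'a tape \<Rightarrow> 'a symbol)"
    by (auto simp: read_def fun_eq_iff)
  then show ?thesis using assms by (simp add: step_def Let_def)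
qed

text \<open>\<open>turing_machine\<close> constrains \<open>delta\<close> only on known states and
  tape symbols; this invariant keeps a run where the constraint applies.\<close>

definition well_formed :: "'a set \<Rightarrow> 'a machine \<Rightarrow> 'a configuration \<Rightarrow> bool" where
  "well_formed \<Sigma> M c \<longleftrightarrow> fst c \<in> states M \<and> length (snd c) = num_tapes M \<and>
     (\<forall>T \<in> set (snd c). range (fst T) \<subseteq> tape_symbols \<Sigma> M)"

lemma well_formed_read:
  "well_formed \<Sigma> M c \<Longrightarrow> set (map read (snd c)) \<subseteq> tape_symbols \<Sigma> M"
  by (auto simp: well_formed_def read_def)

lemma delta_well_formed:
  assumes M: "turing_machine \<Sigma> M" and c: "well_formed \<Sigma> M c" and q: "fst c \<notin> halting M"
  shows "fst (delta M (fst c) (map read (snd c))) \<in> states M"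
    and "length (snd (delta M (fst c) (map read (snd c)))) = num_tapes M"
    and "fst ` set (snd (delta M (fst c) (map read (snd c)))) \<subseteq> tape_symbols \<Sigma> M"
proof -
  have "map read (snd c) \<in> lists (tape_symbols \<Sigma> M)"
    using well_formed_read[OF c] by auto
  moreover have "length (map read (snd c)) = num_tapes M" "fst c \<in> states M - halting M"
    using c q by (auto simp: well_formed_def)
  ultimately have "fst (delta M (fst c) (map read (snd c))) \<in> states M \<and>
        length (snd (delta M (fst c) (map read (snd c)))) = num_tapes M \<and>
        fst ` set (snd (delta M (fst c) (map read (snd c)))) \<subseteq> tape_symbols \<Sigma> M"
    using M unfolding turing_machine_def by blast
  then show "fst (delta M (fst c) (map read (snd c))) \<in> states M"
    and "length (snd (delta M (fst c) (map read (snd c)))) = num_tapes M"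
    and "fst ` set (snd (delta M (fst c) (map read (snd c)))) \<subseteq> tape_symbols \<Sigma> M"
    by blast+
qed

lemma well_formed_step:
  assumes M: "turing_machine \<Sigma> M" and c: "well_formed \<Sigma> M c"
  shows "well_formed \<Sigma> M (step M c)"
proof (cases "fst c \<in> halting M")
  case True
  then show ?thesis using c by (simp add: step_def)
next
  case False
  note d = delta_well_formed[OF M c False]
  have len: "length (snd c) = num_tapes M" using c by (simp add: well_formed_def)
  have "range (fst T) \<subseteq> tape_symbols \<Sigma> M"
    if T: "T \<in> set (map2 act (snd c) (snd (delta M (fst c) (map read (snd c)))))" for T
  proof -
    obtain z where z: "z \<in> set (zip (snd c) (snd (delta M (fst c) (map read (snd c)))))"
      and T_z: "T = (case z of (T', p) \<Rightarrow> act T' p)"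
      using T unfolding set_map by (rule imageE)
    obtain T' p where "z = (T', p)" by (cases z)
    then have T': "T' \<in> set (snd c)" "T = act T' p"
      and p: "p \<in> set (snd (delta M (fst c) (map read (snd c))))"
      using z T_z by (auto dest: set_zip_leftD set_zip_rightD)
    have "range (fst T') \<subseteq> tape_symbols \<Sigma> M" using T'(1) c by (auto simp: well_formed_def)
    moreover have "fst p \<in> tape_symbols \<Sigma> M" using p d(3) by blast
    ultimately show ?thesis by (auto simp: T'(2) act_eq)
  qed
  then show ?thesis
    using d(1,2) len step_not_halted[OF False, of "snd c"] by (simp add: well_formed_def)
qed

lemma well_formed_run:
  assumes "turing_machine \<Sigma> M" "w \<in> lists \<Sigma>"
  shows "well_formed \<Sigma> M (run M w t)"
proof (induction t)
  case 0
  have "tape_of (map Letter w) i \<in> tape_symbols \<Sigma> M" for i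
    using assms(2) by (auto simp: tape_of_def tape_symbols_def)
  then show ?case using assms(1)
    by (auto simp: well_formed_def initial_def turing_machine_def tape_symbols_def)
next
  case (Suc t)
  then show ?case using well_formed_step[OF assms(1)] by (simp add: run_Suc)
qed

text \<open>States and marks are natural numbers; countability provides the codes for symbols and
  control states.\<close>

instance signed :: (countable) countable by countable_datatype

instance symbol :: (countable) countable by countable_datatype

section \<open>Simulating a machine over another alphabet\<close>

text \<open>The simulating machine has no letters from the alphabet of the simulated one, so every
  nonblank symbol, letter or mark, is coded by a mark. \<open>Blank\<close> must stay fixed because
  all but finitely many cells are blank at the start.\<close>

definition enc :: "'b::countable symbol \<Rightarrow> 'a symbol" where
  "enc s = (if s = Blank then Blank else Mark (to_nat s))"

fun dec :: "'a symbol \<Rightarrow> 'b::countable symbol" where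
  "dec (Mark n) = from_nat n"
| "dec _ = Blank"

lemma dec_enc [simp]: "dec (enc s) = s"
  by (simp add: enc_def)

lemma enc_Blank [simp]: "enc Blank = Blank"
  by (simp add: enc_def)

text \<open>Letters without meaning for \<open>N\<close> are read as blanks, so that simulated transitions are always well-formed.\<close>

definition clamp :: "'b set \<Rightarrow> 'b::countable machine \<Rightarrow> 'a symbol \<Rightarrow> 'b symbol" where
  "clamp \<Sigma> N s = (if dec s \<in> tape_symbols \<Sigma> N then dec s else Blank)"

lemma clamp_in [simp]: "clamp \<Sigma> N s \<in> tape_symbols \<Sigma> N"
  by (simp add: clamp_def tape_symbols_def)

lemma clamp_enc: "s \<in> tape_symbols \<Sigma> N \<Longrightarrow> clamp \<Sigma> N (enc s) = s"
  by (simp add: clamp_def)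

text \<open>Only positions relative to the heads are compared, so a simulating tape may be shifted.\<close>

definition tracks :: "'a tape \<Rightarrow> 'b::countable tape \<Rightarrow> bool" where
  "tracks T S \<longleftrightarrow> (\<forall>i. fst T (snd T + i) = enc (fst S (snd S + i)))"

lemma tracks_read: "tracks T S \<Longrightarrow> read T = enc (read S)"
  unfolding tracks_def read_def by (drule spec[of _ 0]) simp

lemma tracks_act: "tracks T S \<Longrightarrow> tracks (act T (enc s, d)) (act S (s, d))"
proof -
  assume T: "tracks T S"
  have "fst (act T (enc s, d)) (snd (act T (enc s, d)) + i) =
      enc (fst (act S (s, d)) (snd (act S (s, d)) + i))" for i
    \<comment> \<open>An offset seen from the moved head is, seen from the old head, shifted by at
      most one.\<close>
    using T[unfolded tracks_def, rule_format, of "i - 1"] T[unfolded tracks_def, rule_format, of i]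
      T[unfolded tracks_def, rule_format, of "i + 1"]
    by (cases d) (auto simp: act_eq algebra_simps)
  then show "tracks (act T (enc s, d)) (act S (s, d))" by (simp add: tracks_def)
qed

lemma tracks_map2_act:
  "list_all2 tracks Ts Ss \<Longrightarrow>
    list_all2 tracks (map2 act Ts (map (map_prod enc id) r)) (map2 act Ss r)"
proof (induction Ts Ss arbitrary: r rule: list_all2_induct)
  case (Cons T Ts S Ss)
  then show ?case
    by (cases r) (auto simp: tracks_act)
qed simp

lemma tracks_clamp:
  assumes "list_all2 tracks Ts Ss" "set (map read Ss) \<subseteq> tape_symbols \<Sigma> N"
  shows "map (clamp \<Sigma> N) (map read Ts) = map read Ss"
  using assms
  by (induction Ts Ss rule: list_all2_induct) (auto simp: tracks_read clamp_enc)

definition idle :: "'a symbol \<Rightarrow> 'a symbol \<times> direction" where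
  "idle s = (s, Stay)"

lemma act_idle [simp]: "act T (idle (read T)) = T"
  by (simp add: act_eq idle_def read_def)

lemma map2_act_idle [simp]: "map2 act Ts (map (idle \<circ> read) Ts) = Ts"
  by (induction Ts) auto

definition simulated ::
  "'b set \<Rightarrow> 'b::countable machine \<Rightarrow> nat \<Rightarrow> 'a symbol list \<Rightarrow> nat \<times> ('a symbol \<times> direction) list" where
  "simulated \<Sigma> N q ss =
     map_prod id (map (map_prod enc id)) (delta N q (map (clamp \<Sigma> N) ss))"

lemma simulated_step:
  assumes N: "turing_machine \<Sigma> N" and c: "well_formed \<Sigma> N c" and q: "fst c \<notin> halting N"
    and Ts: "list_all2 tracks Ts (snd c)"
  shows "fst (simulated \<Sigma> N (fst c) (map read Ts)) = fst (step N c)"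
    and "list_all2 tracks (map2 act Ts (snd (simulated \<Sigma> N (fst c) (map read Ts)))) (snd (step N c))"
    and "length (snd (simulated \<Sigma> N (fst c) (map read Ts))) = num_tapes N"
proof -
  have cl: "map (clamp \<Sigma> N) (map read Ts) = map read (snd c)"
    by (rule tracks_clamp[OF Ts well_formed_read[OF c]])
  have st: "step N c = (fst (delta N (fst c) (map read (snd c))),
      map2 act (snd c) (snd (delta N (fst c) (map read (snd c)))))"
    using step_not_halted[OF q, of "snd c"] by simp
  show "fst (simulated \<Sigma> N (fst c) (map read Ts)) = fst (step N c)"
    unfolding simulated_def cl st by simp
  show "list_all2 tracks (map2 act Ts (snd (simulated \<Sigma> N (fst c) (map read Ts)))) (snd (step N c))"
    unfolding simulated_def cl st using tracks_map2_act[OF Ts] by simp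
  show "length (snd (simulated \<Sigma> N (fst c) (map read Ts))) = num_tapes N"
    unfolding simulated_def cl using delta_well_formed(2)[OF N c q] by simp
qed

text \<open>Nothing is assumed about the symbols in \<open>ss\<close>: \<open>turing_machine\<close>
  quantifies over all tuples of tape symbols, including those that no simulation produces. Clamping
  turns each of them into a legal tuple for \<open>N\<close>.\<close>

lemma simulated_closed:
  assumes N: "turing_machine \<Sigma> N" and q: "q \<in> states N - halting N" and ss: "length ss = num_tapes N"
  shows "fst (simulated \<Sigma> N q ss) \<in> states N"
    and "length (snd (simulated \<Sigma> N q ss)) = num_tapes N"
    and "fst ` set (snd (simulated \<Sigma> N q ss)) \<subseteq> enc ` tape_symbols \<Sigma> N"
proof -
  have "map (clamp \<Sigma> N) ss \<in> lists (tape_symbols \<Sigma> N)" "length (map (clamp \<Sigma> N) ss) = num_tapes N"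
    using ss by auto
  then have *: "fst (delta N q (map (clamp \<Sigma> N) ss)) \<in> states N \<and>
        length (snd (delta N q (map (clamp \<Sigma> N) ss))) = num_tapes N \<and>
        fst ` set (snd (delta N q (map (clamp \<Sigma> N) ss))) \<subseteq> tape_symbols \<Sigma> N"
    using N q unfolding turing_machine_def by blast
  then show "fst (simulated \<Sigma> N q ss) \<in> states N"
    and "length (snd (simulated \<Sigma> N q ss)) = num_tapes N"
    by (simp_all add: simulated_def)
  show "fst ` set (snd (simulated \<Sigma> N q ss)) \<subseteq> enc ` tape_symbols \<Sigma> N"
    using * by (force simp: simulated_def)
qed

section \<open>Transducing the input and running two machines in sequence\<close>

text \<open>\<open>Scan\<close> searches for the right end of the input. \<open>Emit q u v\<close>
  carries the transducer state and what is still to be written, last letter first, of the two blocks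
  for the letter just read. \<open>First\<close> and \<open>Second\<close> wrap the states of the
  two simulated machines.\<close>

datatype 'b control =
  Scan | Emit nat "'b list" "'b list" | First nat | Second nat | Yes | No

instance control :: (countable) countable by countable_datatype

text \<open>\<open>q\<^sub>0\<close> is both the initial state and the only final state that lets
  the first machine start. In the application states stand for left cosets of \<open>G1\<close>, and
  \<open>q\<^sub>0\<close> for \<open>G1\<close> itself.\<close>

locale two_stage =
  fixes X :: "'x set" and \<Sigma> :: "'b::countable set" and \<Sigma>' :: "'b set"
    and N N' :: "'b machine" and L L' :: "'b list set"
    and Q :: "nat set" and q\<^sub>0 :: nat and \<delta> :: "nat \<Rightarrow> 'x \<Rightarrow> nat"
    and out out' :: "nat \<Rightarrow> 'x \<Rightarrow> 'b list" and b :: nat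
  assumes finite_X: "finite X" and N: "decides N \<Sigma> L" and N': "decides N' \<Sigma>' L'"
    and finite_Q: "finite Q" and q\<^sub>0: "q\<^sub>0 \<in> Q"
    and \<delta>: "q \<in> Q \<Longrightarrow> x \<in> X \<Longrightarrow> \<delta> q x \<in> Q"
    and out: "q \<in> Q \<Longrightarrow> x \<in> X \<Longrightarrow> out q x \<in> lists \<Sigma> \<and> length (out q x) \<le> b"
    and out': "q \<in> Q \<Longrightarrow> x \<in> X \<Longrightarrow> out' q x \<in> lists \<Sigma>' \<and> length (out' q x) \<le> b"
begin

text \<open>Recursion on lists processes the last letter first, which is the order in which the
  machine reads the input.\<close>

primrec state :: "'x list \<Rightarrow> nat" where
  "state [] = q\<^sub>0"
| "state (x # w) = \<delta> (state w) x"

primrec emitted :: "'x list \<Rightarrow> 'b list" where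
  "emitted [] = []"
| "emitted (x # w) = out (state w) x @ emitted w"

primrec emitted' :: "'x list \<Rightarrow> 'b list" where
  "emitted' [] = []"
| "emitted' (x # w) = out' (state w) x @ emitted' w"

lemma state_in: "w \<in> lists X \<Longrightarrow> state w \<in> Q"
  by (induction w) (auto simp: q\<^sub>0 \<delta>)

lemma emitted_in: "w \<in> lists X \<Longrightarrow> emitted w \<in> lists \<Sigma> \<and> length (emitted w) \<le> b * length w"
proof (induction w)
  case (Cons x w)
  then show ?case using out[of "state w" x] state_in[of w] by auto
qed simp

lemma emitted'_in: "w \<in> lists X \<Longrightarrow> emitted' w \<in> lists \<Sigma>' \<and> length (emitted' w) \<le> b * length w"
proof (induction w)
  case (Cons x w)
  then show ?case using out'[of "state w" x] state_in[of w] by auto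
qed simp

text \<open>
  Tape 0 holds the input. It is read from right to left, so that the two outputs can be written from
  right to left, which leaves the heads next to their first letters.
\<close>

definition emit :: "'b list \<Rightarrow> 'x symbol list \<Rightarrow> ('x symbol \<times> direction) list" where
  "emit u ss = (case u of [] \<Rightarrow> map idle ss
     | y # _ \<Rightarrow> (enc (Letter y), MoveL) # map idle (tl ss))"

text \<open>After leftward writing the head is one cell to the left of the word; this move puts it
  on the first letter, where a run is expected to begin.\<close>

definition advance :: "'x symbol list \<Rightarrow> ('x symbol \<times> direction) list" where
  "advance ss = (hd ss, MoveR) # map idle (tl ss)"

text \<open>The arguments after the control are what is read on the input tape, on the tapes of
  \<open>N\<close> and on those of \<open>N'\<close>. Both blocks are written in parallel: an
  exhausted list stays empty under \<open>tl\<close> while its tapes idle. A nonletter met while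
  emitting marks the left end of the input.\<close>

fun control_step ::
  "'b control \<Rightarrow> 'x symbol \<Rightarrow> 'x symbol list \<Rightarrow> 'x symbol list \<Rightarrow>
    'b control \<times> ('x symbol \<times> direction) \<times> ('x symbol \<times> direction) list \<times> ('x symbol \<times> direction) list"
  where
  "control_step Scan s us vs = (case s of
     Letter x \<Rightarrow> (Scan, (s, MoveR), map idle us, map idle vs)
   | _ \<Rightarrow> (Emit q\<^sub>0 [] [], (s, MoveL), map idle us, map idle vs))"
| "control_step (Emit q u v) s us vs = (if u = [] \<and> v = [] then (case s of
       Letter x \<Rightarrow> (Emit (\<delta> q x) (rev (out q x)) (rev (out' q x)), (s, MoveL), map idle us, map idle vs)
     | _ \<Rightarrow> (if q = q\<^sub>0 then First (start N) else No, idle s, advance us, advance vs))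
   else (Emit q (tl u) (tl v), idle s, emit u us, emit v vs))"
| "control_step (First p) s us vs =
     (if p = accept N then (Second (start N'), idle s, map idle us, map idle vs)
      else if p = reject N then (No, idle s, map idle us, map idle vs)
      else (First (fst (simulated \<Sigma> N p us)), idle s, snd (simulated \<Sigma> N p us), map idle vs))"
| "control_step (Second p) s us vs =
     (if p = accept N' then (Yes, idle s, map idle us, map idle vs)
      else if p = reject N' then (No, idle s, map idle us, map idle vs)
      else (Second (fst (simulated \<Sigma>' N' p vs)), idle s, map idle us, snd (simulated \<Sigma>' N' p vs)))"
| "control_step c s us vs = (c, idle s, map idle us, map idle vs)"

definition controls :: "'b control set" where
  "controls = {Scan, Yes, No} \<union> First ` states N \<union> Second ` states N' \<union>
     (\<lambda>(q, u, v). Emit q u v) `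
       (Q \<times> {u. set u \<subseteq> \<Sigma> \<and> length u \<le> b} \<times> {v. set v \<subseteq> \<Sigma>' \<and> length v \<le> b})"

definition written :: "'x symbol set" where
  "written = enc ` tape_symbols \<Sigma> N \<union> enc ` tape_symbols \<Sigma>' N'"

definition combined :: "'x machine" where
  "combined = \<lparr>num_tapes = 1 + (num_tapes N + num_tapes N'),
     states = to_nat ` controls,
     marks = {n. Mark n \<in> written},
     start = to_nat (Scan :: 'b control),
     accept = to_nat (Yes :: 'b control),
     reject = to_nat (No :: 'b control),
     delta = (\<lambda>n ss. case control_step (from_nat n) (hd ss) (take (num_tapes N) (tl ss))
           (drop (num_tapes N) (tl ss)) of (c, a, as, bs) \<Rightarrow> (to_nat c, a # as @ bs))\<rparr>"

lemma N_machine: "turing_machine \<Sigma> N" and N'_machine: "turing_machine \<Sigma>' N'"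
  using N N' by (auto simp: decides_def)

lemma combined_simps [simp]:
  "num_tapes combined = 1 + (num_tapes N + num_tapes N')"
  "start combined = to_nat (Scan :: 'b control)"
  "accept combined = to_nat (Yes :: 'b control)"
  "reject combined = to_nat (No :: 'b control)"
  "halting combined = {to_nat (Yes :: 'b control), to_nat (No :: 'b control)}"
  by (simp_all add: combined_def halting_def)

lemma finite_written: "finite written"
  using N_machine N'_machine
  by (auto simp: written_def turing_machine_def tape_symbols_def)

lemma finite_controls: "finite controls"
proof -
  have "finite {u. set u \<subseteq> \<Sigma> \<and> length u \<le> b}" "finite {u. set u \<subseteq> \<Sigma>' \<and> length u \<le> b}"
    using N_machine N'_machine by (auto simp: turing_machine_def intro: finite_lists_length_le)
  then show ?thesis
    using finite_Q N_machine N'_machine by (auto simp: controls_def turing_machine_def)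
qed

lemma written_subset: "written \<subseteq> tape_symbols X combined"
proof
  fix s assume s: "s \<in> written"
  then have "s = Blank \<or> (\<exists>n. s = Mark n)"
    by (auto simp: written_def enc_def)
  then show "s \<in> tape_symbols X combined"
    using s by (auto simp: tape_symbols_def combined_def)
qed

lemma enc_Letter_in:
  "y \<in> \<Sigma> \<Longrightarrow> enc (Letter y) \<in> tape_symbols X combined"
  "y \<in> \<Sigma>' \<Longrightarrow> enc (Letter y) \<in> tape_symbols X combined"
  by (rule subsetD[OF written_subset]; auto simp: written_def tape_symbols_def)+

section \<open>The combined machine is a Turing machine\<close>

lemma control_step_closed:
  assumes c: "c \<in> controls" and ss: "set (s # us @ vs) \<subseteq> tape_symbols X combined"
    and len: "length us = num_tapes N" "length vs = num_tapes N'"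
    and r: "control_step c s us vs = (c', a, as, bs)"
  shows "c' \<in> controls \<and> length as = num_tapes N \<and> length bs = num_tapes N' \<and>
    fst ` set (a # as @ bs) \<subseteq> tape_symbols X combined"
proof -
  define admissible :: "nat \<Rightarrow> ('x symbol \<times> direction) list \<Rightarrow> bool" where
    "admissible n as \<longleftrightarrow> length as = n \<and> fst ` set as \<subseteq> tape_symbols X combined" for n as
  \<comment> \<open>\<open>emit\<close> and \<open>advance\<close> preserve the number of tapes only
    if there is at least one.\<close>
  have ne: "us \<noteq> []" "vs \<noteq> []"
    using len N_machine N'_machine by (auto simp: turing_machine_def)
  have s_in: "s \<in> tape_symbols X combined" and us_in: "set us \<subseteq> tape_symbols X combined"
    and vs_in: "set vs \<subseteq> tape_symbols X combined"
    using ss by auto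
  have idle_admissible: "admissible (length ts) (map idle ts)"
    if "set ts \<subseteq> tape_symbols X combined" for ts :: "'x symbol list"
    using that by (auto simp: admissible_def idle_def)
  have advance_admissible: "admissible (length ts) (advance ts)"
    if "set ts \<subseteq> tape_symbols X combined" "ts \<noteq> []" for ts :: "'x symbol list"
    using that by (cases ts) (auto simp: admissible_def idle_def advance_def)
  have emit_admissible: "admissible (length ts) (emit u ts)"
    if "set ts \<subseteq> tape_symbols X combined" "ts \<noteq> []" "set u \<subseteq> \<Sigma> \<or> set u \<subseteq> \<Sigma>'"
    for ts :: "'x symbol list" and u
    using that enc_Letter_in by (cases ts; cases u) (auto simp: admissible_def idle_def emit_def)
  note adm = idle_admissible[OF us_in, unfolded len] idle_admissible[OF vs_in, unfolded len]
    advance_admissible[OF us_in ne(1), unfolded len] advance_admissible[OF vs_in ne(2), unfolded len]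
  have st: "start N \<in> states N" "start N' \<in> states N'"
    using N_machine N'_machine by (auto simp: turing_machine_def)
  have controls_intros: "Scan \<in> controls" "Yes \<in> controls" "No \<in> controls"
    "p \<in> states N \<Longrightarrow> First p \<in> controls" "p \<in> states N' \<Longrightarrow> Second p \<in> controls"
    "q \<in> Q \<Longrightarrow> set u \<subseteq> \<Sigma> \<Longrightarrow> length u \<le> b \<Longrightarrow> set v \<subseteq> \<Sigma>' \<Longrightarrow> length v \<le> b \<Longrightarrow>
      Emit q u v \<in> controls" for p q u v
    by (auto simp: controls_def image_iff)
  have fst_idle: "fst (idle s) = s" by (simp add: idle_def)
  have "c' \<in> controls \<and> fst a \<in> tape_symbols X combined \<and>
    admissible (num_tapes N) as \<and> admissible (num_tapes N') bs"
  proof (cases c)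
    case Scan
    then show ?thesis using r adm controls_intros q\<^sub>0 s_in by (cases s) auto
  next
    case (Emit q u v)
    then have quv: "q \<in> Q" "set u \<subseteq> \<Sigma>" "set v \<subseteq> \<Sigma>'" "length u \<le> b" "length v \<le> b"
      using c by (auto simp: controls_def)
    show ?thesis
    proof (cases "u = [] \<and> v = []")
      case False
      have "set (tl u) \<subseteq> \<Sigma>" "set (tl v) \<subseteq> \<Sigma>'" "length (tl u) \<le> b" "length (tl v) \<le> b"
        using quv by (cases u; cases v; auto)+
      then have "Emit q (tl u) (tl v) \<in> controls" using quv controls_intros by simp
      moreover have "admissible (num_tapes N) (emit u us)" "admissible (num_tapes N') (emit v vs)"
        using emit_admissible[OF us_in ne(1), of u] emit_admissible[OF vs_in ne(2), of v] quv len
        by simp_all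
      moreover have "(c', a, as, bs) = (Emit q (tl u) (tl v), idle s, emit u us, emit v vs)"
        using False r Emit by auto
      ultimately show ?thesis using s_in fst_idle by simp
    next
      case True
      show ?thesis
      proof (cases "\<exists>x. s = Letter x")
        case True
        then obtain x where x: "s = Letter x" by blast
        then have xX: "x \<in> X" using s_in by (auto simp: tape_symbols_def)
        have "Emit (\<delta> q x) (rev (out q x)) (rev (out' q x)) \<in> controls"
          using \<delta>[OF quv(1) xX] out[OF quv(1) xX] out'[OF quv(1) xX]
          by (intro controls_intros) auto
        moreover have "(c', a, as, bs) =
            (Emit (\<delta> q x) (rev (out q x)) (rev (out' q x)), (s, MoveL), map idle us, map idle vs)"
          using r Emit \<open>u = [] \<and> v = []\<close> x by simp
        ultimately show ?thesis using s_in adm by simp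
      next
        case False
        then have "(c', a, as, bs) =
            (if q = q\<^sub>0 then First (start N) else No, idle s, advance us, advance vs)"
          using True Emit r by (cases s) auto
        then show ?thesis using adm s_in fst_idle st controls_intros by simp
      qed
    qed
  next
    case (First p)
    then have p: "p \<in> states N" using c by (auto simp: controls_def)
    show ?thesis
    proof (cases "p \<in> halting N")
      case True
      then show ?thesis using r First st adm s_in fst_idle controls_intros
        by (auto simp: halting_def split: if_splits)
    next
      case False
      then have "p \<in> states N - halting N" using p by simp
      note sim = simulated_closed[OF N_machine this len(1)]
      have "(c', a, as, bs) =
          (First (fst (simulated \<Sigma> N p us)), idle s, snd (simulated \<Sigma> N p us), map idle vs)"
        using r First False by (simp add: halting_def)
      moreover have "admissible (num_tapes N) (snd (simulated \<Sigma> N p us))"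
        unfolding admissible_def using sim(2) order_trans[OF sim(3)] written_subset
        unfolding written_def by blast
      ultimately show ?thesis using sim(1) adm s_in fst_idle controls_intros by simp
    qed
  next
    case (Second p)
    then have p: "p \<in> states N'" using c by (auto simp: controls_def)
    show ?thesis
    proof (cases "p \<in> halting N'")
      case True
      then show ?thesis using r Second st adm s_in fst_idle controls_intros
        by (auto simp: halting_def split: if_splits)
    next
      case False
      then have "p \<in> states N' - halting N'" using p by simp
      note sim = simulated_closed[OF N'_machine this len(2)]
      have "(c', a, as, bs) =
          (Second (fst (simulated \<Sigma>' N' p vs)), idle s, map idle us, snd (simulated \<Sigma>' N' p vs))"
        using r Second False by (simp add: halting_def)
      moreover have "admissible (num_tapes N') (snd (simulated \<Sigma>' N' p vs))"
        unfolding admissible_def using sim(2) order_trans[OF sim(3)] written_subset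
        unfolding written_def by blast
      ultimately show ?thesis using sim(1) adm s_in fst_idle controls_intros by simp
    qed
  next
    case Yes
    then show ?thesis using r adm s_in fst_idle controls_intros by simp
  next
    case No
    then show ?thesis using r adm s_in fst_idle controls_intros by simp
  qed
  then show ?thesis by (auto simp: admissible_def)
qed

lemma combined_machine: "turing_machine X combined"
proof -
  have "fst (delta combined n ss) \<in> states combined \<and>
        length (snd (delta combined n ss)) = num_tapes combined \<and>
        fst ` set (snd (delta combined n ss)) \<subseteq> tape_symbols X combined"
    if n: "n \<in> states combined" and ss: "ss \<in> lists (tape_symbols X combined)"
      and len: "length ss = num_tapes combined" for n ss
  proof -
    obtain c where c: "n = to_nat c" "c \<in> controls" using n by (auto simp: combined_def)
    obtain s ts where ts: "ss = s # ts" using len by (cases ss) auto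
    define us vs where uvs: "us = take (num_tapes N) ts" "vs = drop (num_tapes N) ts"
    obtain c' a as bs where r: "control_step c s us vs = (c', a, as, bs)"
      by (cases "control_step c s us vs")
    have "set ss \<subseteq> tape_symbols X combined" using ss by auto
    then have "set (s # us @ vs) \<subseteq> tape_symbols X combined"
      using ts by (simp add: uvs)
    from control_step_closed[OF c(2) this _ _ r]
    have "c' \<in> controls \<and> length as = num_tapes N \<and> length bs = num_tapes N' \<and>
        fst ` set (a # as @ bs) \<subseteq> tape_symbols X combined"
      using len ts by (simp add: uvs)
    moreover have "delta combined n ss = (to_nat c', a # as @ bs)"
      using r by (simp add: combined_def c(1) ts uvs)
    ultimately show ?thesis by (auto simp: combined_def)
  qed
  moreover have "finite (marks combined)"
    using finite_vimageI[OF finite_written, of Mark] by (auto simp: combined_def vimage_def inj_def)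
  moreover have "Scan \<in> controls" "Yes \<in> controls" "No \<in> controls" by (auto simp: controls_def)
  then have "start combined \<in> states combined" "halting combined \<subseteq> states combined"
    by (auto simp: combined_def halting_def)
  moreover have "finite (states combined)" using finite_controls by (simp add: combined_def)
  ultimately show ?thesis
    unfolding turing_machine_def using finite_X by auto
qed

section \<open>The scanning and writing phases\<close>

definition configuration :: "'b control \<Rightarrow> 'x tape \<Rightarrow> 'x tape list \<Rightarrow> 'x tape list \<Rightarrow> 'x configuration" where
  "configuration c T Us Vs = (to_nat c, T # Us @ Vs)"

lemma combined_step:
  assumes "c \<noteq> Yes" "c \<noteq> No" "length Us = num_tapes N"
    "control_step c (read T) (map read Us) (map read Vs) = (c', a, as, bs)" "length as = num_tapes N"
  shows "step combined (configuration c T Us Vs) =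
    configuration c' (act T a) (map2 act Us as) (map2 act Vs bs)"
  using assms unfolding configuration_def
  by (subst step_not_halted) (simp_all add: combined_def halting_def)

lemma map2_act_idle_read [simp]: "map2 act Ts (map idle (map read Ts)) = Ts"
  by (induction Ts) auto

lemma combined_step_idle:
  assumes "c \<noteq> Yes" "c \<noteq> No" "length Us = num_tapes N"
    "\<And>us vs. control_step c (read T) us vs = (c', a, map idle us, map idle vs)"
  shows "step combined (configuration c T Us Vs) = configuration c' (act T a) Us Vs"
  using combined_step[OF assms(1-4)] assms(3) by simp

text \<open>The head is one cell to the left of \<open>v\<close>, ready to prepend a letter. Shifted
  by one, the tape looks like an input tape carrying \<open>v\<close>, up to the coding and the
  absolute position.\<close>

definition holds :: "'b list \<Rightarrow> 'x tape \<Rightarrow> bool" where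
  "holds v T \<longleftrightarrow> tracks (fst T, snd T + 1) (tape_of (map Letter v), 0)"

lemma holds_Nil: "holds [] (\<lambda>_. Blank, 0)"
  by (auto simp: holds_def tracks_def tape_of_def)

lemma tape_of_Cons: "tape_of (s # ss) i = (if i = 0 then s else tape_of ss (i - 1))"
  by (auto simp: tape_of_def nth_Cons' nat_diff_distrib')

lemma holds_Cons:
  assumes "holds v T"
  shows "holds (y # v) (act T (enc (Letter y), MoveL))"
  unfolding holds_def tracks_def
proof
  fix i
  show "fst (fst (act T (enc (Letter y), MoveL)), snd (act T (enc (Letter y), MoveL)) + 1)
      (snd (fst (act T (enc (Letter y), MoveL)), snd (act T (enc (Letter y), MoveL)) + 1) + i) =
      enc (fst (tape_of (map Letter (y # v)), 0) (snd (tape_of (map Letter (y # v)), 0) + i))"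
    using assms[unfolded holds_def tracks_def, rule_format, of "i - 1"]
    by (simp add: act_eq tape_of_Cons)
qed

abbreviation blanks :: "nat \<Rightarrow> 'x tape list" where
  "blanks n \<equiv> replicate n (\<lambda>_. Blank, 0)"

text \<open>Invariant of the writing phase: \<open>y\<close> and \<open>z\<close> are the words
  written so far, \<open>u\<close> and \<open>v\<close> the pending blocks. Only the first tape of
  each machine is touched; the others keep their initial form.\<close>

definition emitting ::
  "'x list \<Rightarrow> nat \<Rightarrow> 'b list \<Rightarrow> 'b list \<Rightarrow> int \<Rightarrow> 'b list \<Rightarrow> 'b list \<Rightarrow> 'x configuration \<Rightarrow> bool" where
  "emitting w q u v i y z c \<longleftrightarrow> (\<exists>U V.
     c = configuration (Emit q u v) (tape_of (map Letter w), i)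
           (U # blanks (num_tapes N - 1)) (V # blanks (num_tapes N' - 1)) \<and> holds y U \<and> holds z V)"

lemma emittingI:
  "c = configuration (Emit q u v) (tape_of (map Letter w), i)
      (U # blanks (num_tapes N - 1)) (V # blanks (num_tapes N' - 1)) \<Longrightarrow>
    holds y U \<Longrightarrow> holds z V \<Longrightarrow> emitting w q u v i y z c"
  unfolding emitting_def by blast

lemma emittingE:
  assumes "emitting w q u v i y z c"
  obtains U V where "holds y U" "holds z V"
    "c = configuration (Emit q u v) (tape_of (map Letter w), i)
      (U # blanks (num_tapes N - 1)) (V # blanks (num_tapes N' - 1))"
  using assms unfolding emitting_def by metis

lemma num_tapes_pos: "1 \<le> num_tapes N" "1 \<le> num_tapes N'"
  using N_machine N'_machine by (auto simp: turing_machine_def)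

lemma read_pair [simp]: "read (t, i) = t i"
  by (simp add: read_def)

lemma map2_act_emit:
  assumes "holds y U"
  obtains U' where "holds (take 1 u @ y) U'"
    "map2 act (U # B) (emit u (map read (U # B))) = U' # B"
proof (cases u)
  case Nil
  then show ?thesis using that[of U] assms
    by (simp add: emit_def del: map_map)
next
  case (Cons x u')
  then show ?thesis using that[of "act U (enc (Letter x), MoveL)"] holds_Cons[OF assms, of x]
    by (simp add: emit_def del: map_map)
qed

lemma length_emit: "ss \<noteq> [] \<Longrightarrow> length (emit u ss) = length ss"
  by (cases ss) (auto simp: emit_def split: list.splits)

lemma emit_step:
  assumes uv: "u \<noteq> [] \<or> v \<noteq> []" and c: "emitting w q u v i y z c"
  shows "emitting w q (tl u) (tl v) i (take 1 u @ y) (take 1 v @ z) (step combined c)"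
proof -
  obtain U V where UV: "holds y U" "holds z V"
    and c: "c = configuration (Emit q u v) (tape_of (map Letter w), i)
           (U # blanks (num_tapes N - 1)) (V # blanks (num_tapes N' - 1))"
    using c by (rule emittingE)
  obtain U' where U': "holds (take 1 u @ y) U'" "map2 act (U # blanks (num_tapes N - 1))
      (emit u (map read (U # blanks (num_tapes N - 1)))) = U' # blanks (num_tapes N - 1)"
    by (rule map2_act_emit[OF UV(1)])
  obtain V' where V': "holds (take 1 v @ z) V'" "map2 act (V # blanks (num_tapes N' - 1))
      (emit v (map read (V # blanks (num_tapes N' - 1)))) = V' # blanks (num_tapes N' - 1)"
    by (rule map2_act_emit[OF UV(2)])
  have "control_step (Emit q u v) (read (tape_of (map Letter w), i))
      (map read (U # blanks (num_tapes N - 1))) (map read (V # blanks (num_tapes N' - 1))) =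
      (Emit q (tl u) (tl v), idle (read (tape_of (map Letter w), i)),
        emit u (map read (U # blanks (num_tapes N - 1))), emit v (map read (V # blanks (num_tapes N' - 1))))"
    using uv by auto
  from combined_step[OF _ _ _ this]
  have "step combined c = configuration (Emit q (tl u) (tl v)) (tape_of (map Letter w), i)
           (U' # blanks (num_tapes N - 1)) (V' # blanks (num_tapes N' - 1))"
    unfolding c U'(2) V'(2) act_idle using num_tapes_pos by (simp add: length_emit)
  from emittingI[OF this U'(1) V'(1)] show ?thesis .
qed

text \<open>Parallel writing makes the longer block, not the sum of the two, bound the steps.
  Prepending letter by letter reverses a block, which undoes the reversal made when the block was
  loaded.\<close>

lemma emit_all:
  "emitting w q u v i y z c \<Longrightarrow> length u \<le> n \<Longrightarrow> length v \<le> n \<Longrightarrow>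
    \<exists>m \<le> n. emitting w q [] [] i (rev u @ y) (rev v @ z) ((step combined ^^ m) c)"
proof (induction n arbitrary: u v y z c)
  case 0
  then show ?case by (auto intro: exI[of _ 0])
next
  case (Suc n)
  show ?case
  proof (cases "u = [] \<and> v = []")
    case True
    then show ?thesis using Suc.prems by (auto intro: exI[of _ 0])
  next
    case False
    then have "emitting w q (tl u) (tl v) i (take 1 u @ y) (take 1 v @ z) (step combined c)"
      using emit_step Suc.prems by blast
    moreover have "length (tl u) \<le> n" "length (tl v) \<le> n" using Suc.prems by auto
    ultimately obtain m where m: "m \<le> n"
      "emitting w q [] [] i (rev (tl u) @ take 1 u @ y) (rev (tl v) @ take 1 v @ z)
        ((step combined ^^ m) (step combined c))"
      using Suc.IH by blast
    have "rev (tl x) @ take 1 x = rev x" for x :: "'b list" by (cases x) auto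
    then have "emitting w q [] [] i (rev u @ y) (rev v @ z) ((step combined ^^ Suc m) c)"
      using m(2) by (metis append.assoc comp_apply funpow_Suc_right)
    then show ?thesis using m(1) by (intro exI[of _ "Suc m"]) auto
  qed
qed

lemma letter_step:
  assumes x: "tape_of (map Letter w) i = Letter x" and c: "emitting w q [] [] i y z c"
  shows "emitting w (\<delta> q x) (rev (out q x)) (rev (out' q x)) (i - 1) y z (step combined c)"
proof -
  obtain U V where UV: "holds y U" "holds z V"
    and c: "c = configuration (Emit q [] []) (tape_of (map Letter w), i)
           (U # blanks (num_tapes N - 1)) (V # blanks (num_tapes N' - 1))"
    using c by (rule emittingE)
  have "step combined c =
      configuration (Emit (\<delta> q x) (rev (out q x)) (rev (out' q x))) (tape_of (map Letter w), i - 1)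
           (U # blanks (num_tapes N - 1)) (V # blanks (num_tapes N' - 1))"
    unfolding c
    by (subst combined_step_idle[where a = "(Letter x, MoveL)"
          and c' = "Emit (\<delta> q x) (rev (out q x)) (rev (out' q x))"])
      (use x num_tapes_pos in \<open>simp_all add: fun_upd_idem\<close>)
  from emittingI[OF this UV] show ?thesis .
qed

lemma initial_combined:
  "initial combined w = configuration Scan (tape_of (map Letter w), 0)
     (blanks (num_tapes N)) (blanks (num_tapes N'))"
  by (simp add: initial_def configuration_def replicate_add)

lemma scan_run:
  "t \<le> length w \<Longrightarrow> run combined w t =
    configuration Scan (tape_of (map Letter w), int t) (blanks (num_tapes N)) (blanks (num_tapes N'))"
proof (induction t)
  case 0
  then show ?case by (simp add: initial_combined)
next
  case (Suc t)
  then have x: "tape_of (map Letter w) (int t) = Letter (w ! t)" by (simp add: tape_of_def)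
  have "run combined w (Suc t) = step combined (configuration Scan (tape_of (map Letter w), int t)
      (blanks (num_tapes N)) (blanks (num_tapes N')))"
    using Suc by (simp add: run_Suc)
  also have "\<dots> = configuration Scan (tape_of (map Letter w), int (Suc t))
      (blanks (num_tapes N)) (blanks (num_tapes N'))"
    by (subst combined_step_idle[where a = "(Letter (w ! t), MoveR)" and c' = Scan])
      (use x in \<open>simp_all add: fun_upd_idem add.commute\<close>)
  finally show ?case .
qed

lemma scanned: "emitting w q\<^sub>0 [] [] (int (length w) - 1) [] [] (run combined w (Suc (length w)))"
proof -
  have x: "tape_of (map Letter w) (int (length w)) = Blank" by (simp add: tape_of_def)
  have "run combined w (Suc (length w)) = step combined (configuration Scan
      (tape_of (map Letter w), int (length w)) (blanks (num_tapes N)) (blanks (num_tapes N')))"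
    by (simp add: run_Suc scan_run)
  also have "\<dots> = configuration (Emit q\<^sub>0 [] []) (tape_of (map Letter w), int (length w) - 1)
      (blanks (num_tapes N)) (blanks (num_tapes N'))"
    by (subst combined_step_idle[where a = "(Blank, MoveL)" and c' = "Emit q\<^sub>0 [] []"])
      (use x in \<open>simp_all add: fun_upd_idem\<close>)
  also have "blanks (num_tapes N) = (\<lambda>_. Blank, 0) # blanks (num_tapes N - 1)"
    using num_tapes_pos(1) by (cases "num_tapes N") auto
  also have "blanks (num_tapes N') = (\<lambda>_. Blank, 0) # blanks (num_tapes N' - 1)"
    using num_tapes_pos(2) by (cases "num_tapes N'") auto
  finally show ?thesis by (rule emittingI) (rule holds_Nil)+
qed

text \<open>\<open>s\<close> is the suffix already consumed. Each of its letters costs one step for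
  reading and at most \<open>b\<close> for writing, after the \<open>length w + 1\<close> steps of
  the scan.\<close>

lemma emission:
  assumes "w = p @ s" "w \<in> lists X"
  shows "\<exists>t \<le> Suc (length w) + (b + 1) * length s.
    emitting w (state s) [] [] (int (length p) - 1) (emitted s) (emitted' s) (run combined w t)"
  using assms
proof (induction s arbitrary: p)
  case Nil
  then show ?case using scanned[of w] by auto
next
  case (Cons x s)
  obtain t where t: "t \<le> Suc (length w) + (b + 1) * length s"
    "emitting w (state s) [] [] (int (length p)) (emitted s) (emitted' s) (run combined w t)"
    using Cons.IH[of "p @ [x]"] Cons.prems by auto
  have "tape_of (map Letter w) (int (length p)) = Letter x"
    using Cons.prems by (simp add: tape_of_def nth_append)
  from letter_step[OF this t(2)]
  have *: "emitting w (state (x # s)) (rev (out (state s) x)) (rev (out' (state s) x))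
      (int (length p) - 1) (emitted s) (emitted' s) (run combined w (Suc t))"
    by (simp add: run_Suc)
  have "s \<in> lists X" "x \<in> X" using Cons.prems by auto
  then have "length (rev (out (state s) x)) \<le> b" "length (rev (out' (state s) x)) \<le> b"
    using out out' state_in by auto
  from emit_all[OF * this] obtain m where m: "m \<le> b"
    "emitting w (state (x # s)) [] [] (int (length p) - 1) (emitted (x # s)) (emitted' (x # s))
      ((step combined ^^ m) (run combined w (Suc t)))"
    by auto
  have "(step combined ^^ m) (run combined w (Suc t)) = run combined w (Suc t + m)"
    unfolding run_def funpow_steps ..
  then show ?case using m t(1) by (intro exI[of _ "Suc t + m"]) auto
qed

section \<open>Step-by-step simulation of the two machines\<close>

lemma first_run:
  assumes Us: "list_all2 tracks Us (snd (initial N v))" and v: "v \<in> lists \<Sigma>"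
    and t: "t \<le> run_time N v"
  shows "\<exists>Us'. list_all2 tracks Us' (snd (run N v t)) \<and>
    (step combined ^^ t) (configuration (First (start N)) T Us Vs) =
    configuration (First (fst (run N v t))) T Us' Vs"
  using t
proof (induction t)
  case 0
  then show ?case using Us by (auto simp: initial_def)
next
  case (Suc t)
  then obtain Us' where Us': "list_all2 tracks Us' (snd (run N v t))"
    "(step combined ^^ t) (configuration (First (start N)) T Us Vs) =
      configuration (First (fst (run N v t))) T Us' Vs"
    by auto
  have wf: "well_formed \<Sigma> N (run N v t)" by (rule well_formed_run[OF N_machine v])
  \<comment> \<open>By minimality of \<open>run_time\<close>, no earlier configuration is
    halting.\<close>
  have q: "fst (run N v t) \<notin> halting N"
    using not_less_Least Suc.prems unfolding run_time_def by (meson Suc_le_lessD)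
  note sim = simulated_step[OF N_machine wf q Us'(1)]
  have len: "length Us' = num_tapes N"
    using Us'(1) wf by (auto simp: well_formed_def dest: list_all2_lengthD)
  have "step combined (configuration (First (fst (run N v t))) T Us' Vs) =
      configuration (First (fst (run N v (Suc t)))) T
        (map2 act Us' (snd (simulated \<Sigma> N (fst (run N v t)) (map read Us')))) Vs"
    using q len sim
      combined_step[of "First (fst (run N v t))" Us' T Vs, OF _ _ len]
    by (auto simp: halting_def run_Suc simp del: map_map)
  then show ?case using Us'(2) sim(2) by (auto simp: run_Suc)
qed

lemma second_run:
  assumes Vs: "list_all2 tracks Vs (snd (initial N' v))" and v: "v \<in> lists \<Sigma>'"
    and Us: "length Us = num_tapes N" and t: "t \<le> run_time N' v"
  shows "\<exists>Vs'. list_all2 tracks Vs' (snd (run N' v t)) \<and>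
    (step combined ^^ t) (configuration (Second (start N')) T Us Vs) =
    configuration (Second (fst (run N' v t))) T Us Vs'"
  using t
proof (induction t)
  case 0
  then show ?case using Vs by (auto simp: initial_def)
next
  case (Suc t)
  then obtain Vs' where Vs': "list_all2 tracks Vs' (snd (run N' v t))"
    "(step combined ^^ t) (configuration (Second (start N')) T Us Vs) =
      configuration (Second (fst (run N' v t))) T Us Vs'"
    by auto
  have wf: "well_formed \<Sigma>' N' (run N' v t)" by (rule well_formed_run[OF N'_machine v])
  have q: "fst (run N' v t) \<notin> halting N'"
    using not_less_Least Suc.prems unfolding run_time_def by (meson Suc_le_lessD)
  note sim = simulated_step[OF N'_machine wf q Vs'(1)]
  have "step combined (configuration (Second (fst (run N' v t))) T Us Vs') =
      configuration (Second (fst (run N' v (Suc t)))) T Us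
        (map2 act Vs' (snd (simulated \<Sigma>' N' (fst (run N' v t)) (map read Vs'))))"
    using q Us sim
      combined_step[of "Second (fst (run N' v t))" Us T Vs', OF _ _ Us]
    by (auto simp: halting_def run_Suc simp del: map_map)
  then show ?case using Vs'(2) sim(2) by (auto simp: run_Suc)
qed

lemma list_all2_tracks_initial:
  assumes "holds v U"
  shows "list_all2 tracks ((fst U, snd U + 1) # blanks (num_tapes M - 1)) (snd (initial M v))"
  using assms
  by (auto simp: initial_def holds_def tracks_def list_all2_conv_all_nth nth_Cons' nth_replicate)

lemma start_first:
  assumes w: "w \<in> lists X"
  obtains t U V where "t \<le> (b + 2) * length w + 2"
    "holds (emitted w) U" "holds (emitted' w) V"
    "run combined w t = configuration (if state w = q\<^sub>0 then First (start N) else No)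
      (tape_of (map Letter w), - 1) ((fst U, snd U + 1) # blanks (num_tapes N - 1))
      ((fst V, snd V + 1) # blanks (num_tapes N' - 1))"
proof -
  obtain t where t: "t \<le> Suc (length w) + (b + 1) * length w"
    "emitting w (state w) [] [] (- 1) (emitted w) (emitted' w) (run combined w t)"
    using emission[of w "[]" w] w by auto
  obtain U V where UV: "holds (emitted w) U" "holds (emitted' w) V"
    and c: "run combined w t = configuration (Emit (state w) [] []) (tape_of (map Letter w), - 1)
      (U # blanks (num_tapes N - 1)) (V # blanks (num_tapes N' - 1))"
    using t(2) by (rule emittingE)
  have adv: "map2 act (T # B) (advance (map read (T # B))) = (fst T, snd T + 1) # B"
    for T :: "'x tape" and B
  proof -
    have "act T (read T, MoveR) = (fst T, snd T + 1)" by (simp add: act_eq read_def)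
    then show ?thesis by (simp add: advance_def del: map_map)
  qed
  \<comment> \<open>Cell -1 is blank, and this is how the end of the input is recognized.\<close>
  have "control_step (Emit (state w) [] []) (read (tape_of (map Letter w), - 1)) us vs =
      (if state w = q\<^sub>0 then First (start N) else No, idle (read (tape_of (map Letter w), - 1)),
        advance us, advance vs)" for us vs
    by (simp add: tape_of_def)
  note cs = combined_step[OF _ _ _ this]
  have "step combined (run combined w t) = configuration (if state w = q\<^sub>0 then First (start N) else No)
      (tape_of (map Letter w), - 1) ((fst U, snd U + 1) # blanks (num_tapes N - 1))
      ((fst V, snd V + 1) # blanks (num_tapes N' - 1))"
    unfolding c by (subst cs) (use num_tapes_pos in \<open>simp_all only: adv act_idle, auto simp: advance_def\<close>)
  then show thesis using that[of "Suc t" U V] UV t(1) by (simp add: run_Suc)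
qed

definition accepted :: "'x list set" where
  "accepted = {w. state w = q\<^sub>0 \<and> emitted w \<in> L \<and> emitted' w \<in> L'}"

text \<open>The time of \<open>N'\<close> is charged only to words that pass the first test; the
  average-case bound rests on this. The constant 3 consists of the 2 from \<open>start_first\<close>
  and the step that inspects the verdict of \<open>N\<close>; inspecting the verdict of
  \<open>N'\<close> costs one more.\<close>

lemma combined_halts:
  assumes w: "w \<in> lists X"
  shows "\<exists>t \<le> (b + 2) * length w + 3 + run_time N (emitted w) +
      (if state w = q\<^sub>0 \<and> emitted w \<in> L then run_time N' (emitted' w) + 1 else 0).
    fst (run combined w t) = to_nat (if w \<in> accepted then Yes else No :: 'b control)"
proof -
  let ?T = "(tape_of (map Letter w) :: int \<Rightarrow> 'x symbol, - 1 :: int)"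
  let ?T\<^sub>1 = "run_time N (emitted w)" and ?T\<^sub>2 = "run_time N' (emitted' w)"
  obtain t U V where t: "t \<le> (b + 2) * length w + 2"
    and UV: "holds (emitted w) U" "holds (emitted' w) V"
    and c: "run combined w t = configuration (if state w = q\<^sub>0 then First (start N) else No)
      ?T ((fst U, snd U + 1) # blanks (num_tapes N - 1)) ((fst V, snd V + 1) # blanks (num_tapes N' - 1))"
    using w by (rule start_first)
  define Vs where "Vs = (fst V, snd V + 1) # blanks (num_tapes N' - 1)"
  have v: "emitted w \<in> lists \<Sigma>" and v': "emitted' w \<in> lists \<Sigma>'"
    using emitted_in[OF w] emitted'_in[OF w] by blast+
  have h: "halts N (emitted w)" "fst (final N (emitted w)) = accept N \<longleftrightarrow> emitted w \<in> L"
    and h': "halts N' (emitted' w)" "fst (final N' (emitted' w)) = accept N' \<longleftrightarrow> emitted' w \<in> L'"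
    using N N' v v' unfolding decides_def by blast+
  have fin: "fst (final N (emitted w)) \<in> {accept N, reject N}"
    and fin': "fst (final N' (emitted' w)) \<in> {accept N', reject N'}"
    using halts_run_time[OF h(1)] halts_run_time[OF h'(1)] by (auto simp: final_def halting_def)
  have ne: "accept N \<noteq> reject N" "accept N' \<noteq> reject N'"
    using N_machine N'_machine by (auto simp: turing_machine_def)
  show ?thesis
  proof (cases "state w = q\<^sub>0")
    case False
    then have "fst (run combined w t) = to_nat (if w \<in> accepted then Yes else No :: 'b control)"
      using c by (simp add: configuration_def accepted_def)
    then show ?thesis using t by (intro exI[of _ t]) auto
  next
    case True
    obtain Us where Us: "list_all2 tracks Us (snd (final N (emitted w)))"
      and c1: "(step combined ^^ ?T\<^sub>1) (run combined w t) =
        configuration (First (fst (final N (emitted w)))) ?T Us Vs"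
      using first_run[OF list_all2_tracks_initial[OF UV(1)] v order_refl, of ?T Vs] True c
      unfolding final_def Vs_def by auto
    have c1: "run combined w (t + ?T\<^sub>1) = configuration (First (fst (final N (emitted w)))) ?T Us Vs"
      using c1 unfolding run_def funpow_steps .
    have len: "length Us = num_tapes N"
      using Us well_formed_run[OF N_machine v]
      by (auto simp: well_formed_def final_def dest: list_all2_lengthD)
    have c2: "run combined w (Suc (t + ?T\<^sub>1)) =
        configuration (if emitted w \<in> L then Second (start N') else No) ?T Us Vs"
    proof -
      have "control_step (First (fst (final N (emitted w)))) (read ?T) us vs =
          (if emitted w \<in> L then Second (start N') else No, idle (read ?T), map idle us, map idle vs)"
        for us vs
        using fin h(2) ne(1) by auto
      from combined_step_idle[OF _ _ len this, unfolded act_idle]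
      show ?thesis unfolding run_Suc c1 by simp
    qed
    show ?thesis
    proof (cases "emitted w \<in> L")
      case False
      then have "fst (run combined w (Suc (t + ?T\<^sub>1))) = to_nat (if w \<in> accepted then Yes else No :: 'b control)"
        using c2 by (simp add: configuration_def accepted_def)
      then show ?thesis using t by (intro exI[of _ "Suc (t + ?T\<^sub>1)"]) auto
    next
      case True
      obtain Vs' where c3: "(step combined ^^ ?T\<^sub>2) (run combined w (Suc (t + ?T\<^sub>1))) =
          configuration (Second (fst (final N' (emitted' w)))) ?T Us Vs'"
        using second_run[OF list_all2_tracks_initial[OF UV(2)] v' len order_refl, of ?T] True c2
        unfolding final_def Vs_def by auto
      have c3: "run combined w (Suc (t + ?T\<^sub>1) + ?T\<^sub>2) =
          configuration (Second (fst (final N' (emitted' w)))) ?T Us Vs'"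
        using c3 unfolding run_def funpow_steps .
      have "control_step (Second (fst (final N' (emitted' w)))) (read ?T) us vs =
          (if emitted' w \<in> L' then Yes else No, idle (read ?T), map idle us, map idle vs)"
        for us vs
        using fin' h'(2) ne(2) by auto
      from combined_step_idle[OF _ _ len this, unfolded act_idle]
      have "run combined w (Suc (Suc (t + ?T\<^sub>1) + ?T\<^sub>2)) =
          configuration (if emitted' w \<in> L' then Yes else No) ?T Us Vs'"
        unfolding run_Suc[of _ _ "Suc (t + ?T\<^sub>1) + ?T\<^sub>2"] c3 by simp
      then have "fst (run combined w (Suc (Suc (t + ?T\<^sub>1) + ?T\<^sub>2))) =
          to_nat (if w \<in> accepted then Yes else No :: 'b control)"
        using True \<open>state w = q\<^sub>0\<close> by (simp add: configuration_def accepted_def)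
      then show ?thesis using t True \<open>state w = q\<^sub>0\<close>
        by (intro exI[of _ "Suc (Suc (t + ?T\<^sub>1) + ?T\<^sub>2)"]) simp
    qed
  qed
qed

theorem combined_decides: "decides combined X accepted"
  and combined_run_time: "w \<in> lists X \<Longrightarrow> run_time combined w \<le>
    (b + 2) * length w + 3 + run_time N (emitted w) +
      (if state w = q\<^sub>0 \<and> emitted w \<in> L then run_time N' (emitted' w) + 1 else 0)"
proof -
  have *: "halts combined w \<and> (fst (final combined w) = accept combined \<longleftrightarrow> w \<in> accepted) \<and>
    run_time combined w \<le> (b + 2) * length w + 3 + run_time N (emitted w) +
      (if state w = q\<^sub>0 \<and> emitted w \<in> L then run_time N' (emitted' w) + 1 else 0)"
    if w: "w \<in> lists X" for w
  proof -
    obtain t where t: "t \<le> (b + 2) * length w + 3 + run_time N (emitted w) +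
      (if state w = q\<^sub>0 \<and> emitted w \<in> L then run_time N' (emitted' w) + 1 else 0)"
      "fst (run combined w t) = to_nat (if w \<in> accepted then Yes else No :: 'b control)"
      using combined_halts[OF w] by blast
    then have "fst (run combined w t) \<in> halting combined" by simp
    from run_halted[OF this] show ?thesis using t by auto
  qed
  show "decides combined X accepted"
    using * combined_machine by (auto simp: decides_def)
  show "w \<in> lists X \<Longrightarrow> run_time combined w \<le> (b + 2) * length w + 3 + run_time N (emitted w) +
      (if state w = q\<^sub>0 \<and> emitted w \<in> L then run_time N' (emitted' w) + 1 else 0)"
    using * by blast
qed

end

section \<open>Closed walks in expanding graphs\<close>

text \<open>A Schreier graph seen as an action: each letter permutes \<open>V\<close>, and
  \<open>bar\<close> names the letter of the inverse permutation. The sum in the last assumption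
  counts the edges that leave \<open>S\<close>.\<close>

locale expanding_action =
  fixes V :: "'v set" and X :: "'x set" and go :: "'v \<Rightarrow> 'x \<Rightarrow> 'v" and bar :: "'x \<Rightarrow> 'x"
    and v\<^sub>0 :: 'v and \<epsilon> :: real
  assumes finite_X: "finite X" and v\<^sub>0: "v\<^sub>0 \<in> V"
    and go: "v \<in> V \<Longrightarrow> x \<in> X \<Longrightarrow> go v x \<in> V"
    and bar: "x \<in> X \<Longrightarrow> bar x \<in> X" and bar_bar: "x \<in> X \<Longrightarrow> bar (bar x) = x"
    and go_bar: "v \<in> V \<Longrightarrow> x \<in> X \<Longrightarrow> go (go v x) (bar x) = v"
    and \<epsilon>: "\<epsilon> > 0"
    and expanding: "finite S \<Longrightarrow> S \<subseteq> V \<Longrightarrow>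
      \<epsilon> * real (card S) \<le> (\<Sum>x\<in>X. real (card {v \<in> S. go v x \<notin> S}))"
begin

text \<open>\<open>V\<close> may be infinite, so finitely supported functions with an explicit
  finite window stand in for square-summable ones. Values outside \<open>V\<close> are
  unconstrained.\<close>

definition supported :: "'v set \<Rightarrow> ('v \<Rightarrow> real) \<Rightarrow> bool" where
  "supported W f \<longleftrightarrow> finite W \<and> W \<subseteq> V \<and> (\<forall>v \<in> V - W. f v = 0)"

definition Adj :: "('v \<Rightarrow> real) \<Rightarrow> 'v \<Rightarrow> real" where
  "Adj f v = (\<Sum>x\<in>X. f (go v x))"

definition nbhd :: "'v set \<Rightarrow> 'v set" where
  "nbhd W = W \<union> (\<Union>x\<in>X. (\<lambda>v. go v x) ` W)"

lemma nbhd: "finite W \<Longrightarrow> W \<subseteq> V \<Longrightarrow> finite (nbhd W) \<and> W \<subseteq> nbhd W \<and> nbhd W \<subseteq> V"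
  using finite_X go by (auto simp: nbhd_def)

lemma supported_mono: "supported W f \<Longrightarrow> W \<subseteq> W' \<Longrightarrow> finite W' \<Longrightarrow> W' \<subseteq> V \<Longrightarrow> supported W' f"
  by (auto simp: supported_def)

lemma supported_Adj:
  assumes "supported W f"
  shows "supported (nbhd W) (Adj f)"
proof -
  have W: "finite W" "W \<subseteq> V" using assms by (auto simp: supported_def)
  have "f (go v x) = 0" if "v \<in> V - nbhd W" "x \<in> X" for v x
  proof -
    have "go v x \<notin> W"
    proof
      assume "go v x \<in> W"
      then have "go (go v x) (bar x) \<in> nbhd W" using bar that by (auto simp: nbhd_def)
      then show False using go_bar that by auto
    qed
    then show ?thesis using assms go that by (auto simp: supported_def)
  qed
  then show ?thesis using nbhd[OF W] by (auto simp: supported_def Adj_def)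
qed

text \<open>A letter permutes \<open>V\<close>, so shifting preserves the sum, provided the window
  contains the preimages \<open>go u (bar x)\<close> of the points of \<open>W\<close>;
  \<open>nbhd W\<close> does.\<close>

lemma sum_shift:
  assumes h: "supported W h" and x: "x \<in> X"
  shows "(\<Sum>v\<in>nbhd W. h (go v x)) = (\<Sum>v\<in>W. h v)"
proof -
  have W: "finite W" "W \<subseteq> V" using h by (auto simp: supported_def)
  note n = nbhd[OF W]
  have "(\<Sum>v\<in>nbhd W. h (go v x)) = (\<Sum>v\<in>{v \<in> nbhd W. go v x \<in> W}. h (go v x))"
    using n h go x by (intro sum.mono_neutral_right) (auto simp: supported_def subset_iff)
  also have "\<dots> = (\<Sum>v\<in>W. h v)"
  proof (rule sum.reindex_bij_witness[where i = "\<lambda>u. go u (bar x)" and j = "\<lambda>v. go v x"])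
    fix u assume u: "u \<in> W"
    have "go (go u (bar x)) x = u" using go_bar[of u "bar x"] bar bar_bar u W x by auto
    then show "go (go u (bar x)) x = u" "go u (bar x) \<in> {v \<in> nbhd W. go v x \<in> W}"
      using u bar x by (auto simp: nbhd_def)
  qed (use n go_bar x in auto)
  finally show ?thesis .
qed

text \<open>The adjoint of the shift by \<open>x\<close> is the shift by \<open>bar x\<close>, and
  \<open>bar\<close> merely permutes the letters.\<close>

lemma Adj_symmetric:
  assumes f: "supported W f" and g: "supported W g"
  shows "(\<Sum>v\<in>W. f v * Adj g v) = (\<Sum>v\<in>W. g v * Adj f v)"
proof -
  have W: "finite W" "W \<subseteq> V" using f by (auto simp: supported_def)
  note n = nbhd[OF W]
  have one: "(\<Sum>v\<in>W. f v * g (go v x)) = (\<Sum>v\<in>W. g v * f (go v (bar x)))" if x: "x \<in> X" for x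
  proof -
    have "(\<Sum>v\<in>W. f v * g (go v x)) = (\<Sum>v\<in>nbhd W. f v * g (go v x))"
      using n f by (intro sum.mono_neutral_left) (auto simp: supported_def)
    also have "\<dots> = (\<Sum>v\<in>nbhd W. g (go v x) * f (go (go v x) (bar x)))"
      using n go_bar x by (intro sum.cong) (auto simp: subset_iff)
    also have "\<dots> = (\<Sum>v\<in>W. g v * f (go v (bar x)))"
      using g x by (intro sum_shift[where h = "\<lambda>v. g v * f (go v (bar x))"]) (auto simp: supported_def)
    finally show ?thesis .
  qed
  have "(\<Sum>v\<in>W. f v * Adj g v) = (\<Sum>x\<in>X. \<Sum>v\<in>W. f v * g (go v x))"
    unfolding Adj_def sum_distrib_left by (rule sum.swap)
  also have "\<dots> = (\<Sum>x\<in>X. \<Sum>v\<in>W. g v * f (go v (bar x)))"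
    by (rule sum.cong[OF HOL.refl one])
  also have "\<dots> = (\<Sum>x\<in>X. \<Sum>v\<in>W. g v * f (go v x))"
    by (rule sum.reindex_bij_witness[where i = bar and j = bar]) (auto simp: bar bar_bar)
  also have "\<dots> = (\<Sum>v\<in>W. g v * Adj f v)"
    unfolding Adj_def sum_distrib_left by (rule sum.swap)
  finally show ?thesis .
qed

text \<open>
  The discrete coarea inequality: subtracting the least value of \<open>g\<close> on its support strips off a
  multiple of an indicator function, for which the claim is the expansion hypothesis.
\<close>

lemma coarea:
  assumes "supported S g" "\<And>v. v \<in> V \<Longrightarrow> 0 \<le> g v"
  shows "\<epsilon> * (\<Sum>v\<in>S. g v) \<le> (\<Sum>x\<in>X. \<Sum>v\<in>S. max 0 (g v - g (go v x)))"
  using assms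
proof (induction "card S" arbitrary: S g rule: less_induct)
  case less
  have S: "finite S" "S \<subseteq> V" and g0: "\<And>v. v \<in> V \<Longrightarrow> v \<notin> S \<Longrightarrow> g v = 0"
    using less.prems(1) by (auto simp: supported_def)
  show ?case
  proof (cases "S = {}")
    case False
    define m where "m = Min (g ` S)"
    obtain u where u: "u \<in> S" "g u = m"
      using Min_in[of "g ` S"] S False unfolding m_def by fastforce
    have m_le: "m \<le> g v" if "v \<in> S" for v
      using that S unfolding m_def by simp
    define g' where "g' v = (if v \<in> S then g v - m else 0)" for v
    have g'_nonneg: "0 \<le> g' v" for v using m_le by (simp add: g'_def)
    \<comment> \<open>Lowering by the minimum annihilates the function at \<open>u\<close>, so the
      support shrinks although the sums over \<open>S\<close> do not change.\<close>
    have "card (S - {u}) < card S" using u S by (metis card_Diff1_less)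
    moreover have "supported (S - {u}) g'" using S u by (auto simp: supported_def g'_def)
    ultimately have IH: "\<epsilon> * (\<Sum>v\<in>S - {u}. g' v) \<le>
        (\<Sum>x\<in>X. \<Sum>v\<in>S - {u}. max 0 (g' v - g' (go v x)))"
      using less.hyps g'_nonneg by blast
    have g'u: "g' u = 0" using u by (simp add: g'_def)
    have sum_g': "(\<Sum>v\<in>S - {u}. g' v) = (\<Sum>v\<in>S. g' v)"
      using u S g'u by (simp add: sum.remove)
    have sum_max: "(\<Sum>v\<in>S - {u}. max 0 (g' v - g' (go v x))) = (\<Sum>v\<in>S. max 0 (g' v - g' (go v x)))"
      for x
      using u S g'u g'_nonneg[of "go u x"] by (simp add: sum.remove)
    \<comment> \<open>Inside \<open>S\<close> the constant \<open>m\<close> cancels. An edge leaving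
      \<open>S\<close> drops to 0 from height \<open>m + g' v\<close>, and its two parts are
      collected separately.\<close>
    have split: "max 0 (g v - g (go v x)) = m * of_bool (go v x \<notin> S) + max 0 (g' v - g' (go v x))"
      if "v \<in> S" "x \<in> X" for v x
    proof (cases "go v x \<in> S")
      case True
      then show ?thesis using that by (simp add: g'_def)
    next
      case False
      then have "g (go v x) = 0" using g0 go that S by auto
      then show ?thesis using False that m_le[of v] less.prems(2)[of v] S by (auto simp: g'_def)
    qed
    have m: "0 \<le> m" using u less.prems(2) S by auto
    have count: "(\<Sum>v\<in>S. m * of_bool (go v x \<notin> S)) = m * real (card {v \<in> S. go v x \<notin> S})" for x
      using S by (simp add: Int_def flip: sum_distrib_left)
    have "\<epsilon> * (\<Sum>v\<in>S. g v) = m * (\<epsilon> * real (card S)) + \<epsilon> * (\<Sum>v\<in>S. g' v)"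
      by (simp add: g'_def sum_subtractf algebra_simps)
    also have "\<dots> \<le> m * (\<Sum>x\<in>X. real (card {v \<in> S. go v x \<notin> S})) +
        (\<Sum>x\<in>X. \<Sum>v\<in>S. max 0 (g' v - g' (go v x)))"
      using IH sum_g' sum_max mult_left_mono[OF expanding[OF S] m] by simp
    also have "\<dots> = (\<Sum>x\<in>X. \<Sum>v\<in>S. m * of_bool (go v x \<notin> S) + max 0 (g' v - g' (go v x)))"
      by (simp add: sum.distrib count sum_distrib_left)
    also have "\<dots> = (\<Sum>x\<in>X. \<Sum>v\<in>S. max 0 (g v - g (go v x)))"
      by (intro sum.cong HOL.refl) (simp add: split)
    finally show ?thesis .
  qed simp
qed

section \<open>Cheeger's inequality and the norm of the adjacency operator\<close>

abbreviation d :: real where "d \<equiv> real (card X)"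

lemma d_pos: "0 < d"
proof (rule ccontr)
  assume "\<not> 0 < d"
  then have "X = {}" using finite_X by auto
  then show False using expanding[of "{v\<^sub>0}"] v\<^sub>0 \<epsilon> by simp
qed

text \<open>The first term is the Cheeger bound; the second keeps \<open>\<rho>\<close> positive, so
  that it can be divided by.\<close>

definition \<rho> :: real where
  "\<rho> = max (d - \<epsilon>\<^sup>2 / (8 * d)) (d / 2)"

lemma \<rho>_bounds: "0 < \<rho>" "\<rho> < d"
  using d_pos \<epsilon> by (auto simp: \<rho>_def)

text \<open>Coarea is applied to the square of \<open>f\<close>. Each difference a^2 - b^2 = (a -
  b)(a + b) is split by the weighted inequality of arithmetic and geometric means, in place of
  Cauchy-Schwarz; the sum of the (a - b)^2 is the gap between \<open>d * sq\<close> and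
  \<open>B\<close>.\<close>

lemma cheeger_nonneg:
  assumes f: "supported W f" and nn: "\<And>v. v \<in> V \<Longrightarrow> 0 \<le> f v"
  shows "(\<Sum>v\<in>W. f v * Adj f v) \<le> \<rho> * (\<Sum>v\<in>W. (f v)\<^sup>2)"
proof -
  have W: "finite W" "W \<subseteq> V" using f by (auto simp: supported_def)
  note n = nbhd[OF W]
  define sq where "sq = (\<Sum>v\<in>W. (f v)\<^sup>2)"
  define B where "B = (\<Sum>v\<in>W. f v * Adj f v)"
  \<comment> \<open>This weight makes the (a + b)^2 part at most \<open>\<epsilon> * sq / 2\<close>,
    half of the left-hand side of the coarea inequality.\<close>
  define \<eta> where "\<eta> = \<epsilon> / (4 * d)"
  have \<eta>: "\<eta> > 0" using \<epsilon> d_pos by (simp add: \<eta>_def)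
  have fsq: "supported W (\<lambda>v. (f v)\<^sup>2)" using f by (auto simp: supported_def)
  have sq1: "(\<Sum>v\<in>nbhd W. (f v)\<^sup>2) = sq"
    unfolding sq_def using n f by (intro sum.mono_neutral_right) (auto simp: supported_def)
  have sq2: "(\<Sum>v\<in>nbhd W. (f (go v x))\<^sup>2) = sq" if "x \<in> X" for x
    unfolding sq_def using sum_shift[OF fsq that] .
  have B': "(\<Sum>x\<in>X. \<Sum>v\<in>nbhd W. f v * f (go v x)) = B"
  proof -
    have "(\<Sum>x\<in>X. \<Sum>v\<in>nbhd W. f v * f (go v x)) = (\<Sum>v\<in>nbhd W. f v * Adj f v)"
      unfolding Adj_def sum_distrib_left by (rule sum.swap)
    also have "\<dots> = B"
      unfolding B_def using n f by (intro sum.mono_neutral_right) (auto simp: supported_def)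
    finally show ?thesis .
  qed
  \<comment> \<open>For every letter both squares sum to \<open>sq\<close>, so any combination of
    a^2 + b^2 and ab can be evaluated at once.\<close>
  have form: "(\<Sum>x\<in>X. \<Sum>v\<in>nbhd W. \<alpha> * ((f v)\<^sup>2 + (f (go v x))\<^sup>2) + \<beta> * (f v * f (go v x))) =
      \<alpha> * (2 * d * sq) + \<beta> * B" for \<alpha> \<beta>
  proof -
    have "(\<Sum>x\<in>X. \<Sum>v\<in>nbhd W. \<alpha> * ((f v)\<^sup>2 + (f (go v x))\<^sup>2) + \<beta> * (f v * f (go v x))) =
        (\<Sum>x\<in>X. \<alpha> * (2 * sq) + \<beta> * (\<Sum>v\<in>nbhd W. f v * f (go v x)))"
      by (intro sum.cong HOL.refl) (simp add: sum.distrib sq1 sq2 flip: sum_distrib_left)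
    also have "\<dots> = \<alpha> * (2 * d * sq) + \<beta> * B"
      by (simp add: sum.distrib B' flip: sum_distrib_left)
    finally show ?thesis .
  qed
  have pt: "0 \<le> (1 / 2) * (a\<^sup>2 + b\<^sup>2) + (- 1) * (a * b)" for a b :: real
    using zero_le_power2[of "a - b"] by (simp add: power2_diff)
  have "0 \<le> (1 / 2) * (2 * d * sq) + (- 1) * B"
    unfolding form[symmetric] by (intro sum_nonneg pt)
  then have B_le: "B \<le> d * sq" by simp
  have "\<epsilon> * sq \<le> (\<Sum>x\<in>X. \<Sum>v\<in>W. max 0 ((f v)\<^sup>2 - (f (go v x))\<^sup>2))"
    unfolding sq_def by (rule coarea[OF fsq]) simp
  also have "\<dots> \<le> (\<Sum>x\<in>X. \<Sum>v\<in>nbhd W. max 0 ((f v)\<^sup>2 - (f (go v x))\<^sup>2))"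
    using n by (intro sum_mono sum_mono2) auto
  also have "\<dots> \<le> (\<Sum>x\<in>X. \<Sum>v\<in>nbhd W. (1 / (2 * \<eta>) + \<eta> / 2) * ((f v)\<^sup>2 + (f (go v x))\<^sup>2) +
      (\<eta> - 1 / \<eta>) * (f v * f (go v x)))"
  proof (intro sum_mono)
    fix x v
    define a b where "a = f v" and "b = f (go v x)"
    have e: "(1 / (2 * \<eta>) + \<eta> / 2) * (a\<^sup>2 + b\<^sup>2) + (\<eta> - 1 / \<eta>) * (a * b) =
        (a - b)\<^sup>2 / (2 * \<eta>) + \<eta> / 2 * (a + b)\<^sup>2"
      using \<eta> by (simp add: field_simps power2_eq_square)
    have "(a - b)\<^sup>2 / (2 * \<eta>) + \<eta> / 2 * (a + b)\<^sup>2 - (a\<^sup>2 - b\<^sup>2) =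
        ((a - b) - \<eta> * (a + b))\<^sup>2 / (2 * \<eta>)"
      using \<eta> by (simp add: field_simps power2_eq_square)
    also have "\<dots> \<ge> 0" using \<eta> by simp
    finally have "a\<^sup>2 - b\<^sup>2 \<le> (a - b)\<^sup>2 / (2 * \<eta>) + \<eta> / 2 * (a + b)\<^sup>2" by simp
    moreover have "0 \<le> (a - b)\<^sup>2 / (2 * \<eta>) + \<eta> / 2 * (a + b)\<^sup>2" using \<eta> by simp
    ultimately show "max 0 ((f v)\<^sup>2 - (f (go v x))\<^sup>2) \<le> (1 / (2 * \<eta>) + \<eta> / 2) *
        ((f v)\<^sup>2 + (f (go v x))\<^sup>2) + (\<eta> - 1 / \<eta>) * (f v * f (go v x))"
      using e unfolding a_def b_def by simp
  qed
  also have "\<dots> = (1 / (2 * \<eta>) + \<eta> / 2) * (2 * d * sq) + (\<eta> - 1 / \<eta>) * B"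
    by (rule form)
  also have "\<dots> = (d * sq - B) / \<eta> + \<eta> * (d * sq + B)"
    using \<eta> by (simp add: field_simps)
  also have "\<dots> \<le> (d * sq - B) / \<eta> + \<eta> * (2 * (d * sq))"
    using B_le \<eta> by (simp add: mult.commute)
  also have "\<eta> * (2 * (d * sq)) = \<epsilon> * sq / 2"
    using d_pos by (simp add: \<eta>_def)
  finally have "\<epsilon> * sq / 2 \<le> (d * sq - B) / \<eta>" by linarith
  then have "\<epsilon> * sq / 2 * \<eta> \<le> d * sq - B" using \<eta> by (simp add: pos_le_divide_eq)
  moreover have "\<epsilon> * sq / 2 * \<eta> = \<epsilon>\<^sup>2 / (8 * d) * sq"
    by (simp add: \<eta>_def power2_eq_square)
  ultimately have "B \<le> d * sq - \<epsilon>\<^sup>2 / (8 * d) * sq" by linarith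
  then have "B \<le> (d - \<epsilon>\<^sup>2 / (8 * d)) * sq" unfolding left_diff_distrib .
  also have "\<dots> \<le> \<rho> * sq"
    unfolding sq_def by (intro mult_right_mono sum_nonneg) (auto simp: \<rho>_def)
  finally show ?thesis by (simp add: B_def sq_def)
qed

text \<open>Replacing \<open>f\<close> by its absolute value keeps the squares and can only enlarge
  the form, since \<open>Adj\<close> has nonnegative entries. The lower bound that this also gives
  is needed for the polarization.\<close>

lemma cheeger:
  assumes f: "supported W f"
  shows "\<bar>\<Sum>v\<in>W. f v * Adj f v\<bar> \<le> \<rho> * (\<Sum>v\<in>W. (f v)\<^sup>2)"
proof -
  have "\<bar>\<Sum>v\<in>W. f v * Adj f v\<bar> \<le> (\<Sum>v\<in>W. \<bar>f v * Adj f v\<bar>)" by (rule sum_abs)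
  also have "\<dots> \<le> (\<Sum>v\<in>W. \<bar>f v\<bar> * Adj (\<lambda>v. \<bar>f v\<bar>) v)"
    unfolding abs_mult Adj_def by (intro sum_mono mult_left_mono sum_abs) auto
  also have "\<dots> \<le> \<rho> * (\<Sum>v\<in>W. \<bar>f v\<bar>\<^sup>2)"
    using f by (intro cheeger_nonneg) (auto simp: supported_def)
  finally show ?thesis by simp
qed

text \<open>Polarization turns the bound on the quadratic form into a bound on the operator norm.\<close>

lemma Adj_contraction:
  assumes f: "supported W f"
  shows "(\<Sum>v\<in>nbhd W. (Adj f v)\<^sup>2) \<le> \<rho>\<^sup>2 * (\<Sum>v\<in>W. (f v)\<^sup>2)"
proof -
  have W: "finite W" "W \<subseteq> V" using f by (auto simp: supported_def)
  note n = nbhd[OF W]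
  define W' where "W' = nbhd W"
  define t where "t = 1 / \<rho>"
  define F where "F = (\<Sum>v\<in>W'. (f v)\<^sup>2)"
  define G where "G = (\<Sum>v\<in>W'. (Adj f v)\<^sup>2)"
  have f': "supported W' f" and g: "supported W' (Adj f)"
    using supported_mono[OF f] n supported_Adj[OF f] by (auto simp: W'_def)
  have F: "(\<Sum>v\<in>W. (f v)\<^sup>2) = F"
    unfolding F_def W'_def using n f by (intro sum.mono_neutral_left) (auto simp: supported_def)
  have Adj_lin: "Adj (\<lambda>v. f v + s * Adj f v) v = Adj f v + s * Adj (Adj f) v" for s v
    by (simp add: Adj_def sum.distrib sum_distrib_left)
  have quad: "(\<Sum>v\<in>W'. (f v + s * Adj f v) * Adj (\<lambda>v. f v + s * Adj f v) v) =
      (\<Sum>v\<in>W'. f v * Adj f v) + s * (2 * G) + s\<^sup>2 * (\<Sum>v\<in>W'. Adj f v * Adj (Adj f) v)" for s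
  proof -
    have "(\<Sum>v\<in>W'. (f v + s * Adj f v) * Adj (\<lambda>v. f v + s * Adj f v) v) =
      (\<Sum>v\<in>W'. f v * Adj f v) + s * ((\<Sum>v\<in>W'. f v * Adj (Adj f) v) + G) +
        s\<^sup>2 * (\<Sum>v\<in>W'. Adj f v * Adj (Adj f) v)"
      unfolding Adj_lin G_def
      by (simp add: algebra_simps power2_eq_square sum.distrib sum_distrib_left)
    moreover have "(\<Sum>v\<in>W'. f v * Adj (Adj f) v) = G"
      using Adj_symmetric[OF f' g] by (simp add: G_def power2_eq_square)
    ultimately show ?thesis by simp
  qed
  have norm: "(\<Sum>v\<in>W'. (f v + s * Adj f v)\<^sup>2) = F + s * (2 * (\<Sum>v\<in>W'. f v * Adj f v)) + s\<^sup>2 * G" for s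
    unfolding F_def G_def
    by (simp add: algebra_simps power2_eq_square sum.distrib sum_distrib_left)
  have supp: "supported W' (\<lambda>v. f v + s * Adj f v)" for s
    using f' g by (auto simp: supported_def)
  note c = cheeger[OF supp, unfolded quad norm]
  \<comment> \<open>In the difference of the forms at \<open>t\<close> and \<open>- t\<close> only
    the mixed term, by symmetry \<open>4 * t * G\<close>, survives, while the norms add up as in the
    parallelogram law. With \<open>t = 1 / \<rho>\<close> half of the left-hand side absorbs the
    term in \<open>G\<close> on the right.\<close>
  have "4 * t * G \<le> \<rho> * (2 * F + 2 * t\<^sup>2 * G)"
    using c[of t] c[of "- t"] by (simp add: algebra_simps)
  then have "4 * G \<le> 2 * \<rho>\<^sup>2 * F + 2 * G"
    using \<rho>_bounds(1) by (simp add: t_def field_simps power2_eq_square)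
  then show ?thesis using F by (simp add: G_def W'_def)
qed

section \<open>Counting closed walks\<close>

definition closed_words :: "nat \<Rightarrow> 'v \<Rightarrow> 'x list set" where
  "closed_words n v = {w \<in> lists X. length w = n \<and> foldl go v w = v\<^sub>0}"

lemma finite_closed_words: "finite (closed_words n v)"
  by (rule finite_subset[OF _ finite_lists_length_eq[OF finite_X, of n]])
    (auto simp: closed_words_def)

text \<open>The end point is fixed and the start varies, so splitting off the first letter is one
  application of \<open>Adj\<close>.\<close>

lemma card_closed_words_Suc:
  "real (card (closed_words (Suc n) v)) = Adj (\<lambda>v. real (card (closed_words n v))) v"
proof -
  have "closed_words (Suc n) v = (\<Union>x\<in>X. (#) x ` closed_words n (go v x))"
    by (auto simp: closed_words_def length_Suc_conv image_iff)
  then have "card (closed_words (Suc n) v) = (\<Sum>x\<in>X. card ((#) x ` closed_words n (go v x)))"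
    using finite_X finite_closed_words by (subst card_UN_disjoint[symmetric]) auto
  then show ?thesis by (simp add: Adj_def card_image)
qed

text \<open>The counts are the n-th iterate of \<open>Adj\<close> on the point mass at
  \<open>v\<^sub>0\<close>, whose norm is at most \<open>\<rho> ^ n\<close>; a single value does not
  exceed the norm.\<close>

theorem card_closed_words: "real (card (closed_words n v\<^sub>0)) \<le> \<rho> ^ n"
proof -
  define f where "f n v = real (card (closed_words n v))" for n v
  have f_Suc: "f (Suc n) = Adj (f n)" for n
    unfolding f_def card_closed_words_Suc fun_eq_iff by simp
  have "\<exists>W. supported W (f n) \<and> v\<^sub>0 \<in> W \<and> (\<Sum>v\<in>W. (f n v)\<^sup>2) \<le> (\<rho> ^ n)\<^sup>2"
  proof (induction n)
    case 0
    have "closed_words 0 v = (if v = v\<^sub>0 then {[]} else {})" for v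
      by (auto simp: closed_words_def)
    then show ?case using v\<^sub>0 by (intro exI[of _ "{v\<^sub>0}"]) (auto simp: supported_def f_def)
  next
    case (Suc n)
    then obtain W where W: "supported W (f n)" "v\<^sub>0 \<in> W" "(\<Sum>v\<in>W. (f n v)\<^sup>2) \<le> (\<rho> ^ n)\<^sup>2" by blast
    have "(\<Sum>v\<in>nbhd W. (f (Suc n) v)\<^sup>2) \<le> \<rho>\<^sup>2 * (\<Sum>v\<in>W. (f n v)\<^sup>2)"
      using Adj_contraction[OF W(1)] by (simp add: f_Suc)
    also have "\<dots> \<le> \<rho>\<^sup>2 * (\<rho> ^ n)\<^sup>2" using W(3) by (intro mult_left_mono) auto
    also have "\<dots> = (\<rho> ^ Suc n)\<^sup>2" by (simp add: power_mult_distrib)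
    finally show ?case using supported_Adj[OF W(1)] W(2)
      by (intro exI[of _ "nbhd W"]) (auto simp: f_Suc nbhd_def)
  qed
  then obtain W where W: "supported W (f n)" "v\<^sub>0 \<in> W" "(\<Sum>v\<in>W. (f n v)\<^sup>2) \<le> (\<rho> ^ n)\<^sup>2" by blast
  have "(f n v\<^sub>0)\<^sup>2 \<le> (\<Sum>v\<in>W. (f n v)\<^sup>2)"
    using W by (intro member_le_sum) (auto simp: supported_def)
  then have "(f n v\<^sub>0)\<^sup>2 \<le> (\<rho> ^ n)\<^sup>2" using W(3) by linarith
  then show ?thesis using \<rho>_bounds(1) by (auto simp: f_def intro: power2_le_imp_le)
qed

end

section \<open>Words and cosets\<close>

lemma formal_inverse_in: "x \<in> signed_alphabet A \<Longrightarrow> formal_inverse x \<in> signed_alphabet A"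
  by (auto simp: signed_alphabet_def)

lemma formal_inverse_inverse [simp]: "formal_inverse (formal_inverse x) = x"
  by (cases x) auto

lemma finite_signed_alphabet: "finite A \<Longrightarrow> finite (signed_alphabet A)"
  by (simp add: signed_alphabet_def)

lemma word_value_Nil [simp]: "word_value G \<pi> [] = \<one>\<^bsub>G\<^esub>"
  and word_value_Cons [simp]: "word_value G \<pi> (x # w) = letter_value G \<pi> x \<otimes>\<^bsub>G\<^esub> word_value G \<pi> w"
  by (simp_all add: word_value_def)

context group
begin

lemma cancel_left:
  assumes "x \<in> carrier G" "y \<in> carrier G"
  shows "inv x \<otimes> (x \<otimes> y) = y" "x \<otimes> (inv x \<otimes> y) = y"
  using assms by (simp_all flip: m_assoc)

lemma letter_value_closed:
  "\<pi> ` A \<subseteq> carrier G \<Longrightarrow> x \<in> signed_alphabet A \<Longrightarrow> letter_value G \<pi> x \<in> carrier G"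
  by (auto simp: signed_alphabet_def)

lemma letter_value_inverse:
  "\<pi> ` A \<subseteq> carrier G \<Longrightarrow> x \<in> signed_alphabet A \<Longrightarrow>
    letter_value G \<pi> (formal_inverse x) = inv (letter_value G \<pi> x)"
  by (auto simp: signed_alphabet_def)

lemma word_value_closed:
  "\<pi> ` A \<subseteq> carrier G \<Longrightarrow> w \<in> lists (signed_alphabet A) \<Longrightarrow> word_value G \<pi> w \<in> carrier G"
  by (induction w) (auto simp: letter_value_closed)

lemma word_value_append:
  "\<pi> ` A \<subseteq> carrier G \<Longrightarrow> u \<in> lists (signed_alphabet A) \<Longrightarrow> v \<in> lists (signed_alphabet A) \<Longrightarrow>
    word_value G \<pi> (u @ v) = word_value G \<pi> u \<otimes> word_value G \<pi> v"
  by (induction u) (auto simp: letter_value_closed word_value_closed m_assoc)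

lemma generated_by_words:
  assumes A: "generating_alphabet G A \<pi>" and g: "g \<in> carrier G"
  obtains w where "w \<in> lists (signed_alphabet A)" "word_value G \<pi> w = g"
proof -
  have \<pi>: "\<pi> ` A \<subseteq> carrier G" and "g \<in> generate G (\<pi> ` A)"
    using A g by (auto simp: generating_alphabet_def)
  from this(2) have "\<exists>w \<in> lists (signed_alphabet A). word_value G \<pi> w = g"
  proof (induction rule: generate.induct)
    case one
    then show ?case by (intro bexI[of _ "[]"]) auto
  next
    case (incl h)
    then obtain a where "a \<in> A" "h = \<pi> a" by blast
    then show ?case using \<pi> by (intro bexI[of _ "[Pos a]"]) (auto simp: signed_alphabet_def)
  next
    case (inv h)
    then obtain a where "a \<in> A" "h = \<pi> a" by blast
    then show ?case using \<pi> by (intro bexI[of _ "[Neg a]"]) (auto simp: signed_alphabet_def)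
  next
    case (eng h1 h2)
    then obtain u v where "u \<in> lists (signed_alphabet A)" "word_value G \<pi> u = h1"
      "v \<in> lists (signed_alphabet A)" "word_value G \<pi> v = h2"
      by blast
    then show ?case using word_value_append[OF \<pi>, of u v] by (intro bexI[of _ "u @ v"]) auto
  qed
  then show thesis using that by blast
qed

lemma foldl_r_coset:
  assumes \<pi>: "\<pi> ` A \<subseteq> carrier G" and C: "C \<subseteq> carrier G" and w: "w \<in> lists (signed_alphabet A)"
  shows "foldl (\<lambda>C x. C #> letter_value G \<pi> x) C w = C #> word_value G \<pi> w"
  using C w
proof (induction w arbitrary: C)
  case Nil
  then show ?case by (simp add: coset_mult_one)
next
  case (Cons x w)
  then have x: "letter_value G \<pi> x \<in> carrier G" and w: "w \<in> lists (signed_alphabet A)"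
    using letter_value_closed[OF \<pi>] by auto
  have "C #> letter_value G \<pi> x \<subseteq> carrier G" using Cons.prems x by (simp add: r_coset_subset_G)
  from Cons.IH[OF this w] show ?case
    using coset_mult_assoc[OF Cons.prems(1) x word_value_closed[OF \<pi> w]] by simp
qed

end

section \<open>Pulling \<open>K\<close> back along an epimorphism from a subgroup of finite
  index\<close>

locale finite_index_epi = G: group G + G': group G'
  for G :: "('g, 'm) monoid_scheme" (structure) and G' :: "('h, 'n) monoid_scheme" +
  fixes G1 :: "'g set" and K :: "'h set" and \<phi> :: "'g \<Rightarrow> 'h"
  assumes G1: "subgroup G1 G" and finite_index: "finite (rcosets G1)"
    and \<phi>: "\<phi> \<in> epi (G\<lparr>carrier := G1\<rparr>) G'" and K: "subgroup K G'"
begin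

lemma G1_carrier: "g \<in> G1 \<Longrightarrow> g \<in> carrier G"
  using G1 subgroup.mem_carrier by fast

lemma G1_closed [simp]: "\<one> \<in> G1" "g \<in> G1 \<Longrightarrow> h \<in> G1 \<Longrightarrow> g \<otimes> h \<in> G1" "g \<in> G1 \<Longrightarrow> inv g \<in> G1"
  using G1 by (auto simp: subgroup.one_closed subgroup.m_closed subgroup.m_inv_closed)

lemma \<phi>_in: "g \<in> G1 \<Longrightarrow> \<phi> g \<in> carrier G'"
  and \<phi>_mult: "g \<in> G1 \<Longrightarrow> h \<in> G1 \<Longrightarrow> \<phi> (g \<otimes> h) = \<phi> g \<otimes>\<^bsub>G'\<^esub> \<phi> h"
  using \<phi> by (auto simp: epi_def hom_def)

lemma \<phi>_surj:
  assumes "c \<in> carrier G'"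
  shows "\<exists>g \<in> G1. \<phi> g = c"
proof -
  have "\<phi> ` G1 = carrier G'" using \<phi> by (simp add: epi_def)
  then have "c \<in> \<phi> ` G1" using assms by simp
  then show ?thesis by (rule imageE) blast
qed

lemma \<phi>_one: "\<phi> \<one> = \<one>\<^bsub>G'\<^esub>"
proof -
  have "\<phi> \<one> \<otimes>\<^bsub>G'\<^esub> \<phi> \<one> = \<phi> \<one>" using \<phi>_mult[of \<one> \<one>] by simp
  then show ?thesis using G'.l_cancel_one[of "\<phi> \<one>" "\<phi> \<one>"] \<phi>_in[of \<one>] by simp
qed

lemma \<phi>_inv:
  assumes g: "g \<in> G1"
  shows "\<phi> (inv g) = inv\<^bsub>G'\<^esub> \<phi> g"
proof (rule G'.inv_equality[symmetric])
  show "\<phi> (inv g) \<otimes>\<^bsub>G'\<^esub> \<phi> g = \<one>\<^bsub>G'\<^esub>"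
    using \<phi>_mult[of "inv g" g] g G1_carrier[OF g] \<phi>_one by simp
qed (use g \<phi>_in in auto)

definition preimage :: "'g set" where
  "preimage = {g \<in> G1. \<phi> g \<in> K}"

lemma preimage_subgroup: "subgroup preimage G"
proof (rule G.subgroupI)
  show "preimage \<noteq> {}" using \<phi>_one K by (auto simp: preimage_def subgroup.one_closed intro!: exI[of _ \<one>])
qed (auto simp: preimage_def G1_carrier \<phi>_mult \<phi>_inv K subgroup.m_closed subgroup.m_inv_closed)

lemma transversal:
  obtains T where "finite T" "T \<subseteq> carrier G" "\<And>g. g \<in> carrier G \<Longrightarrow> \<exists>t \<in> T. g \<otimes> inv t \<in> G1"
proof -
  have "\<exists>t \<in> carrier G. C = G1 #> t" if "C \<in> rcosets G1" for C
    using that by (auto simp: RCOSETS_def)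
  then have "\<forall>C \<in> rcosets G1. \<exists>t. t \<in> carrier G \<and> C = G1 #> t" by blast
  from bchoice[OF this] obtain r where
    r: "\<And>C. C \<in> rcosets G1 \<Longrightarrow> r C \<in> carrier G \<and> C = G1 #> r C" by blast
  show thesis
  proof (rule that[of "r ` (rcosets G1)"])
    fix g assume g: "g \<in> carrier G"
    define t where "t = r (G1 #> g)"
    have C: "G1 #> g \<in> rcosets G1" using g by (auto simp: RCOSETS_def)
    have t: "t \<in> carrier G" "G1 #> g = G1 #> t" using r[OF C] by (auto simp: t_def)
    have "g \<in> G1 #> t" using G.rcos_self[OF g G1] t by simp
    then obtain h where "h \<in> G1" "g = h \<otimes> t" by (auto simp: r_coset_def)
    then have "g \<otimes> inv t \<in> G1" using t(1) by (simp add: G.m_assoc G1_carrier)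
    then show "\<exists>t \<in> r ` (rcosets G1). g \<otimes> inv t \<in> G1" using C t_def by blast
  qed (use finite_index r in auto)
qed

text \<open>Embeds the cosets of \<open>K\<close> onto the cosets of its preimage that lie in \<open>G1 #> t\<close>.\<close>

definition lift :: "'g \<Rightarrow> 'h set \<Rightarrow> 'g set" where
  "lift t C = (\<lambda>h. h \<otimes> t) ` {h \<in> G1. \<phi> h \<in> C}"

lemma lift_r_coset:
  assumes h: "h \<in> G1" and t: "t \<in> carrier G"
  shows "lift t (K #>\<^bsub>G'\<^esub> \<phi> h) = preimage #> (h \<otimes> t)"
proof -
  have "\<phi> k \<in> K #>\<^bsub>G'\<^esub> \<phi> h \<longleftrightarrow> k \<otimes> inv h \<in> preimage" if k: "k \<in> G1" for k
  proof -
    have "\<phi> k \<in> K #>\<^bsub>G'\<^esub> \<phi> h \<longleftrightarrow> \<phi> k \<otimes>\<^bsub>G'\<^esub> inv\<^bsub>G'\<^esub> \<phi> h \<in> K"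
      using subgroup.rcos_module[OF K G'.is_group] \<phi>_in h k by simp
    then show ?thesis using h k by (simp add: preimage_def \<phi>_mult \<phi>_inv)
  qed
  moreover have "g \<in> preimage #> (h \<otimes> t) \<longleftrightarrow> (\<exists>k \<in> G1. k \<otimes> inv h \<in> preimage \<and> g = k \<otimes> t)" for g
  proof
    assume "g \<in> preimage #> (h \<otimes> t)"
    then obtain p where p: "p \<in> preimage" "g = p \<otimes> (h \<otimes> t)" by (auto simp: r_coset_def)
    have pG: "p \<in> G1" using p by (simp add: preimage_def)
    have "(p \<otimes> h) \<otimes> inv h = p" using pG h by (simp add: G.m_assoc G1_carrier)
    moreover have "g = (p \<otimes> h) \<otimes> t" using p pG h t by (simp add: G.m_assoc G1_carrier)
    ultimately show "\<exists>k \<in> G1. k \<otimes> inv h \<in> preimage \<and> g = k \<otimes> t"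
      using pG h p(1) by (intro bexI[of _ "p \<otimes> h"]) auto
  next
    assume "\<exists>k \<in> G1. k \<otimes> inv h \<in> preimage \<and> g = k \<otimes> t"
    then obtain k where k: "k \<in> G1" "k \<otimes> inv h \<in> preimage" "g = k \<otimes> t" by blast
    have "(k \<otimes> inv h) \<otimes> (h \<otimes> t) = k \<otimes> t"
      using k(1) h t G1_carrier by (simp add: G.m_assoc G.cancel_left)
    then show "g \<in> preimage #> (h \<otimes> t)" using k by (force simp: r_coset_def)
  qed
  ultimately show ?thesis by (auto simp: lift_def)
qed

lemma K_coset:
  assumes "C \<in> rcosets\<^bsub>G'\<^esub> K"
  shows "\<exists>h \<in> G1. C = K #>\<^bsub>G'\<^esub> \<phi> h"
proof -
  obtain c where "c \<in> carrier G'" "C = K #>\<^bsub>G'\<^esub> c"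
    using assms unfolding RCOSETS_def by blast
  then show ?thesis using \<phi>_surj[of c] by blast
qed

text \<open>Right translation by \<open>t\<close> is injective, and since \<phi> is onto, a coset is
  recovered as the image of its preimage.\<close>

lemma inj_on_lift:
  assumes t: "t \<in> carrier G"
  shows "inj_on (lift t) (rcosets\<^bsub>G'\<^esub> K)"
proof (rule inj_onI)
  fix C D assume C: "C \<in> rcosets\<^bsub>G'\<^esub> K" and D: "D \<in> rcosets\<^bsub>G'\<^esub> K" and eq: "lift t C = lift t D"
  have im: "\<phi> ` {h \<in> G1. \<phi> h \<in> E} = E" if "E \<in> rcosets\<^bsub>G'\<^esub> K" for E
  proof -
    have "E \<subseteq> carrier G'" using subgroup.rcosets_carrier[OF K G'.is_group that] .
    then have "\<exists>h \<in> G1. \<phi> h = c" if "c \<in> E" for c using \<phi>_surj that by blast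
    then show ?thesis by (auto simp: image_iff)
  qed
  have inj: "inj_on (\<lambda>h. h \<otimes> t) G1" using t G1_carrier by (auto simp: inj_on_def)
  have sub: "{h \<in> G1. \<phi> h \<in> E} \<subseteq> G1" for E by blast
  have "{h \<in> G1. \<phi> h \<in> C} = {h \<in> G1. \<phi> h \<in> D}"
    by (rule iffD1[OF inj_on_image_eq_iff[OF inj sub sub] eq[unfolded lift_def]])
  then show "C = D"
    by (rule box_equals[OF arg_cong[where f = "image \<phi>"] im[OF C] im[OF D]])
qed

text \<open>The conjugate appears because \<open>k\<close> must be inserted between \<open>h\<close>
  and \<open>t\<close>: (h t)(t^-1 k t) = (h k) t. The conjugate need not lie in
  \<open>G1\<close>.\<close>

lemma lift_mult:
  assumes t: "t \<in> carrier G" and C: "C \<in> rcosets\<^bsub>G'\<^esub> K" and k: "k \<in> G1"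
  shows "lift t (C #>\<^bsub>G'\<^esub> \<phi> k) = lift t C #> (inv t \<otimes> k \<otimes> t)"
proof -
  obtain h where h: "h \<in> G1" "C = K #>\<^bsub>G'\<^esub> \<phi> h" using K_coset[OF C] by blast
  have KG: "K \<subseteq> carrier G'" and pG: "preimage \<subseteq> carrier G"
    using K preimage_subgroup by (auto simp: subgroup.subset)
  note [simp] = G1_carrier[OF h(1)] G1_carrier[OF k] t
  have "(h \<otimes> t) \<otimes> (inv t \<otimes> k \<otimes> t) = (h \<otimes> k) \<otimes> t"
    by (simp add: G.m_assoc G.cancel_left)
  moreover have "C #>\<^bsub>G'\<^esub> \<phi> k = K #>\<^bsub>G'\<^esub> \<phi> (h \<otimes> k)"
    using h k KG by (simp add: G'.coset_mult_assoc \<phi>_in \<phi>_mult)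
  ultimately show ?thesis
    using h k pG by (simp add: lift_r_coset G.coset_mult_assoc)
qed

end

lemma (in group) r_coset_inj:
  "C \<subseteq> carrier G \<Longrightarrow> x \<in> carrier G \<Longrightarrow> C #> x #> inv x = C"
  by (simp add: coset_mult_assoc coset_mult_one)

section \<open>Expansion of the Schreier graph over the preimage\<close>

context finite_index_epi
begin

lemma rcosets_preimage_subset: "v \<in> rcosets preimage \<Longrightarrow> v \<subseteq> carrier G"
  using subgroup.rcosets_carrier[OF preimage_subgroup G.is_group] .

lemma rcosets_preimage_mult:
  assumes "v \<in> rcosets preimage" "g \<in> carrier G"
  shows "v #> g \<in> rcosets preimage"
proof -
  obtain h where h: "h \<in> carrier G" "v = preimage #> h"
    using assms(1) unfolding RCOSETS_def by blast
  have "v #> g = preimage #> (h \<otimes> g)"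
    unfolding h(2) using G.coset_mult_assoc[OF subgroup.subset[OF preimage_subgroup] h(1) assms(2)] .
  then show ?thesis using h assms(2) unfolding RCOSETS_def by blast
qed

text \<open>A vertex that \<open>u\<close> carries out of \<open>S\<close> leaves \<open>S\<close>
  for the first time at some letter of \<open>u\<close>. Right multiplication is injective on
  cosets, so each position of \<open>u\<close> accounts for at most as many vertices as
  \<open>S\<close> has boundary edges.\<close>

lemma displacement:
  assumes \<pi>: "\<pi> ` A \<subseteq> carrier G" and A: "finite A"
    and S: "finite S" "S \<subseteq> rcosets preimage" and u: "u \<in> lists (signed_alphabet A)"
  shows "card {v \<in> S. v #> word_value G \<pi> u \<notin> S} \<le>
    length u * (\<Sum>x \<in> signed_alphabet A. card {v \<in> S. v #> letter_value G \<pi> x \<notin> S})"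
  using u
proof (induction u rule: list.induct)
  case Nil
  then show ?case using S rcosets_preimage_subset by (auto simp: G.coset_mult_one subset_iff)
next
  case (Cons x u)
  let ?D = "\<Sum>x \<in> signed_alphabet A. card {v \<in> S. v #> letter_value G \<pi> x \<notin> S}"
  define a where "a = letter_value G \<pi> x"
  define b where "b = word_value G \<pi> u"
  have a: "a \<in> carrier G" and b: "b \<in> carrier G" and x: "x \<in> signed_alphabet A"
    using Cons.prems G.letter_value_closed[OF \<pi>] G.word_value_closed[OF \<pi>]
    by (auto simp: a_def b_def)
  have sub: "v \<subseteq> carrier G" if "v \<in> S" for v using S(2) rcosets_preimage_subset that by blast
  have "{v \<in> S. v #> (a \<otimes> b) \<notin> S} \<subseteq> {v \<in> S. v #> a \<notin> S} \<union> {v \<in> S. v #> a \<in> S \<and> v #> a #> b \<notin> S}"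
    using G.coset_mult_assoc[OF sub a b] by auto
  then have "card {v \<in> S. v #> (a \<otimes> b) \<notin> S} \<le>
      card {v \<in> S. v #> a \<notin> S} + card {v \<in> S. v #> a \<in> S \<and> v #> a #> b \<notin> S}"
    by (intro order_trans[OF card_mono card_Un_le]) (use S(1) in auto)
  also have "card {v \<in> S. v #> a \<in> S \<and> v #> a #> b \<notin> S} \<le> card {v \<in> S. v #> b \<notin> S}"
  proof (rule card_inj_on_le)
    show "inj_on (\<lambda>v. v #> a) {v \<in> S. v #> a \<in> S \<and> v #> a #> b \<notin> S}"
      by (rule inj_on_inverseI[where g = "\<lambda>v. v #> inv a"]) (use G.r_coset_inj[OF sub a] in auto)
  qed (use S(1) in auto)
  also have "\<dots> \<le> length u * ?D" using Cons by (simp add: b_def)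
  also have "card {v \<in> S. v #> a \<notin> S} \<le> ?D"
    unfolding a_def using finite_signed_alphabet[OF A] x by (intro member_le_sum) auto
  finally show ?case by (simp add: a_def b_def)
qed

text \<open>For each \<open>t\<close> in the transversal the cosets of \<open>K\<close> whose lifts
  lie in \<open>S\<close> form a finite set, which expands in the graph of \<open>G'\<close>. Each
  edge leaving it lifts to a path labelled by a fixed word over \<open>A\<close> that starts in
  \<open>S\<close> and ends outside, and \<open>displacement\<close> bounds the number of such paths
  by the boundary of \<open>S\<close>.\<close>

lemma expanding_preimage:
  assumes na: "non_amenable_over G' K" and A: "generating_alphabet G A \<pi>"
  shows "\<exists>\<epsilon>::real. \<epsilon> > 0 \<and> (\<forall>S. finite S \<and> S \<subseteq> rcosets preimage \<longrightarrow>
    \<epsilon> * real (card S) \<le>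
      (\<Sum>x \<in> signed_alphabet A. real (card {v \<in> S. v #> letter_value G \<pi> x \<notin> S})))"
proof -
  obtain B :: "nat set" and \<pi>' \<epsilon> where B: "generating_alphabet G' B \<pi>'" and \<epsilon>: "\<epsilon> > (0::real)"
    and ex: "\<And>S. finite S \<Longrightarrow> S \<noteq> {} \<Longrightarrow> S \<subseteq> rcosets\<^bsub>G'\<^esub> K \<Longrightarrow> \<epsilon> * real (card S) \<le>
      real (card {e \<in> (rcosets\<^bsub>G'\<^esub> K) \<times> signed_alphabet B. fst e \<in> S \<and>
        (case e of (v, x) \<Rightarrow> v #>\<^bsub>G'\<^esub> letter_value G' \<pi>' x) \<in> (rcosets\<^bsub>G'\<^esub> K) - S})"
    using na unfolding non_amenable_over_def non_amenable_def schreier_graph_def by auto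
  let ?B = "signed_alphabet B"
  have \<pi>: "\<pi> ` A \<subseteq> carrier G" "finite A" and \<pi>': "\<pi>' ` B \<subseteq> carrier G'" "finite B"
    using A B by (auto simp: generating_alphabet_def)
  have finB: "finite ?B" using finite_signed_alphabet[OF \<pi>'(2)] .
  obtain T where T: "finite T" "T \<subseteq> carrier G" "\<And>g. g \<in> carrier G \<Longrightarrow> \<exists>t \<in> T. g \<otimes> inv t \<in> G1"
    using transversal by blast
  have "\<exists>k \<in> G1. \<phi> k = letter_value G' \<pi>' x" if "x \<in> ?B" for x
    using \<phi>_surj G'.letter_value_closed[OF \<pi>'(1) that] by blast
  then have "\<forall>x \<in> ?B. \<exists>k. k \<in> G1 \<and> \<phi> k = letter_value G' \<pi>' x" by blast
  from bchoice[OF this] obtain k where k: "\<And>x. x \<in> ?B \<Longrightarrow> k x \<in> G1 \<and> \<phi> (k x) = letter_value G' \<pi>' x"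
    by blast
  have "\<exists>u \<in> lists (signed_alphabet A). word_value G \<pi> u = inv t \<otimes> k x \<otimes> t"
    if "t \<in> T" "x \<in> ?B" for t x
  proof -
    have "t \<in> carrier G" "k x \<in> carrier G" using that T(2) k[OF that(2)] G1_carrier by auto
    then have "inv t \<otimes> k x \<otimes> t \<in> carrier G" by simp
    from G.generated_by_words[OF A this] show ?thesis by blast
  qed
  then have "\<forall>p \<in> T \<times> ?B. \<exists>u. u \<in> lists (signed_alphabet A) \<and>
      word_value G \<pi> u = inv (fst p) \<otimes> k (snd p) \<otimes> fst p"
    by fastforce
  from bchoice[OF this] obtain u where u: "\<And>t x. t \<in> T \<Longrightarrow> x \<in> ?B \<Longrightarrow>
      u (t, x) \<in> lists (signed_alphabet A) \<and> word_value G \<pi> (u (t, x)) = inv t \<otimes> k x \<otimes> t"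
    by fastforce
  define M where "M = (\<Sum>t\<in>T. \<Sum>x\<in>?B. length (u (t, x)))"
  have main: "\<epsilon> * real (card S) \<le>
      real M * (\<Sum>x \<in> signed_alphabet A. real (card {v \<in> S. v #> letter_value G \<pi> x \<notin> S}))"
    if S: "finite S" "S \<subseteq> rcosets preimage" for S
  proof -
    let ?D = "\<Sum>x \<in> signed_alphabet A. card {v \<in> S. v #> letter_value G \<pi> x \<notin> S}"
    define R where "R t = {C \<in> rcosets\<^bsub>G'\<^esub> K. lift t C \<in> S}" for t
    have inj: "inj_on (lift t) (R t)" if "t \<in> T" for t
      using inj_on_subset[OF inj_on_lift] T(2) that by (auto simp: R_def)
    have img: "lift t ` R t \<subseteq> S" for t by (auto simp: R_def)
    have finR: "finite (R t)" if "t \<in> T" for t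
      using finite_subset[OF img S(1)] inj[OF that] finite_imageD by blast
    have "S \<subseteq> (\<Union>t\<in>T. lift t ` R t)"
    proof
      fix v assume v: "v \<in> S"
      then obtain g where g: "g \<in> carrier G" "v = preimage #> g"
        using S(2) unfolding RCOSETS_def by blast
      obtain t where t: "t \<in> T" "g \<otimes> inv t \<in> G1" using T(3)[OF g(1)] by blast
      then have tG: "t \<in> carrier G" using T(2) by blast
      have "(g \<otimes> inv t) \<otimes> t = g" using g(1) tG by (simp add: G.m_assoc)
      then have "lift t (K #>\<^bsub>G'\<^esub> \<phi> (g \<otimes> inv t)) = v" using lift_r_coset[OF t(2) tG] g(2) by simp
      moreover have "K #>\<^bsub>G'\<^esub> \<phi> (g \<otimes> inv t) \<in> rcosets\<^bsub>G'\<^esub> K"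
        using \<phi>_in[OF t(2)] by (auto simp: RCOSETS_def)
      ultimately show "v \<in> (\<Union>t\<in>T. lift t ` R t)" using v t(1) by (auto simp: R_def)
    qed
    then have "card S \<le> (\<Sum>t\<in>T. card (R t))"
      using card_mono[of "\<Union>t\<in>T. lift t ` R t" S] card_UN_le[OF T(1), of "\<lambda>t. lift t ` R t"]
        finR T(1) inj by (simp add: card_image)
    then have "\<epsilon> * real (card S) \<le> \<epsilon> * real (\<Sum>t\<in>T. card (R t))"
      using \<epsilon> by (intro mult_left_mono) (simp_all only: of_nat_le_iff)
    also have "\<dots> = (\<Sum>t\<in>T. \<epsilon> * real (card (R t)))" by (simp add: sum_distrib_left)
    also have "\<dots> \<le> (\<Sum>t\<in>T. real (\<Sum>x\<in>?B. length (u (t, x)) * ?D))"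
    proof (rule sum_mono)
      fix t assume t: "t \<in> T"
      then have tG: "t \<in> carrier G" using T(2) by blast
      have moved: "card {C \<in> R t. C #>\<^bsub>G'\<^esub> letter_value G' \<pi>' x \<in> (rcosets\<^bsub>G'\<^esub> K) - R t} \<le> length (u (t, x)) * ?D"
        if x: "x \<in> ?B" for x
      proof -
        have "card {C \<in> R t. C #>\<^bsub>G'\<^esub> letter_value G' \<pi>' x \<in> (rcosets\<^bsub>G'\<^esub> K) - R t} \<le>
            card {v \<in> S. v #> word_value G \<pi> (u (t, x)) \<notin> S}"
        proof (rule card_inj_on_le)
          show "inj_on (lift t) {C \<in> R t. C #>\<^bsub>G'\<^esub> letter_value G' \<pi>' x \<in> (rcosets\<^bsub>G'\<^esub> K) - R t}"
            by (rule inj_on_subset[OF inj[OF t]]) auto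
          \<comment> \<open>The target is again a coset of \<open>K\<close>; not being in
            \<open>R t\<close>, it must have its lift outside \<open>S\<close>, and by
            \<open>lift_mult\<close> that lift is the end of the path.\<close>
          have "lift t C #> word_value G \<pi> (u (t, x)) \<notin> S"
            if "C \<in> R t" "C #>\<^bsub>G'\<^esub> letter_value G' \<pi>' x \<in> (rcosets\<^bsub>G'\<^esub> K) - R t" for C
            using that lift_mult[OF tG, of C "k x"] k[OF x] u[OF t x] by (auto simp: R_def)
          then show "lift t ` {C \<in> R t. C #>\<^bsub>G'\<^esub> letter_value G' \<pi>' x \<in> (rcosets\<^bsub>G'\<^esub> K) - R t} \<subseteq>
              {v \<in> S. v #> word_value G \<pi> (u (t, x)) \<notin> S}"
            by (auto simp: R_def)
        qed (use S(1) in auto)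
        also have "\<dots> \<le> length (u (t, x)) * ?D"
          using displacement[OF \<pi> S] u[OF t x] by blast
        finally show ?thesis .
      qed
      show "\<epsilon> * real (card (R t)) \<le> real (\<Sum>x\<in>?B. length (u (t, x)) * ?D)"
      proof (cases "R t = {}")
        case False
        let ?E = "{e \<in> (rcosets\<^bsub>G'\<^esub> K) \<times> ?B. fst e \<in> R t \<and>
          (case e of (v, x) \<Rightarrow> v #>\<^bsub>G'\<^esub> letter_value G' \<pi>' x) \<in> (rcosets\<^bsub>G'\<^esub> K) - R t}"
        have E: "?E = (\<Union>x\<in>?B. (\<lambda>C. (C, x)) `
            {C \<in> R t. C #>\<^bsub>G'\<^esub> letter_value G' \<pi>' x \<in> (rcosets\<^bsub>G'\<^esub> K) - R t})"
          by (auto simp: R_def)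
        have "card ?E \<le> (\<Sum>x\<in>?B. card ((\<lambda>C. (C, x)) `
            {C \<in> R t. C #>\<^bsub>G'\<^esub> letter_value G' \<pi>' x \<in> (rcosets\<^bsub>G'\<^esub> K) - R t}))"
          unfolding E by (rule card_UN_le[OF finB])
        also have "\<dots> \<le> (\<Sum>x\<in>?B. length (u (t, x)) * ?D)"
          by (rule sum_mono, subst card_image) (simp add: inj_on_def, rule moved)
        finally have "card ?E \<le> (\<Sum>x\<in>?B. length (u (t, x)) * ?D)" .
        moreover have "\<epsilon> * real (card (R t)) \<le> real (card ?E)"
          using ex[OF finR[OF t] False] by (auto simp: R_def)
        ultimately show ?thesis by linarith
      qed (simp add: sum_nonneg)
    qed
    also have "\<dots> = real M * real ?D" by (simp add: M_def sum_distrib_right)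
    finally show ?thesis by simp
  qed
  show ?thesis
  \<comment> \<open>The summand 1 guards against \<open>M = 0\<close>.\<close>
  proof (intro exI[of _ "\<epsilon> / (real M + 1)"] conjI allI impI)
    show "0 < \<epsilon> / (real M + 1)" using \<epsilon> by simp
    fix S assume "finite S \<and> S \<subseteq> rcosets preimage"
    then have S: "finite S" "S \<subseteq> rcosets preimage" by blast+
    have "0 \<le> (\<Sum>x \<in> signed_alphabet A. real (card {v \<in> S. v #> letter_value G \<pi> x \<notin> S}))"
      by (intro sum_nonneg) simp
    then have "\<epsilon> * real (card S) \<le> (real M + 1) *
        (\<Sum>x \<in> signed_alphabet A. real (card {v \<in> S. v #> letter_value G \<pi> x \<notin> S}))"
      using main[OF S] by (simp add: distrib_right)
    then show "\<epsilon> / (real M + 1) * real (card S) \<le>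
        (\<Sum>x \<in> signed_alphabet A. real (card {v \<in> S. v #> letter_value G \<pi> x \<notin> S}))"
      by (simp add: field_simps)
  qed
qed

text \<open>A word with value in the preimage labels a closed walk at the base coset, the preimage
  itself.\<close>

theorem exponentially_few:
  assumes na: "non_amenable_over G' K" and A: "generating_alphabet G A \<pi>"
  obtains r :: real where "0 < r" "r < real (card (signed_alphabet A))"
    "\<And>n. real (card {w \<in> lists (signed_alphabet A). length w = n \<and> word_value G \<pi> w \<in> preimage}) \<le> r ^ n"
proof -
  have \<pi>: "\<pi> ` A \<subseteq> carrier G" "finite A" using A by (auto simp: generating_alphabet_def)
  obtain \<epsilon> :: real where \<epsilon>: "\<epsilon> > 0" "\<And>S. finite S \<Longrightarrow> S \<subseteq> rcosets preimage \<Longrightarrow>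
    \<epsilon> * real (card S) \<le>
      (\<Sum>x \<in> signed_alphabet A. real (card {v \<in> S. v #> letter_value G \<pi> x \<notin> S}))"
    using expanding_preimage[OF na A] by blast
  have pG: "preimage \<subseteq> carrier G" using subgroup.subset[OF preimage_subgroup] .
  interpret act: expanding_action "rcosets preimage" "signed_alphabet A"
    "\<lambda>C x. C #> letter_value G \<pi> x" formal_inverse preimage \<epsilon>
  proof
    show "preimage \<in> rcosets preimage"
      using G.coset_mult_one[OF pG] unfolding RCOSETS_def by force
    fix v x assume v: "v \<in> rcosets preimage" and x: "x \<in> signed_alphabet A"
    note x' = G.letter_value_closed[OF \<pi>(1) x]
    show "v #> letter_value G \<pi> x \<in> rcosets preimage" using rcosets_preimage_mult[OF v x'] .
    show "v #> letter_value G \<pi> x #> letter_value G \<pi> (formal_inverse x) = v"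
      using G.r_coset_inj[OF rcosets_preimage_subset[OF v] x'] G.letter_value_inverse[OF \<pi>(1) x]
      by simp
  next
    fix x assume x: "x \<in> signed_alphabet A"
    show "formal_inverse x \<in> signed_alphabet A" using x by (rule formal_inverse_in)
    show "formal_inverse (formal_inverse x) = x" by simp
  next
    show "finite (signed_alphabet A)" using \<pi>(2) by (rule finite_signed_alphabet)
  qed (fact \<epsilon>)+
  show thesis
  proof (rule that[of act.\<rho>])
    fix n
    have "{w \<in> lists (signed_alphabet A). length w = n \<and> word_value G \<pi> w \<in> preimage} \<subseteq>
        act.closed_words n preimage"
      using G.foldl_r_coset[OF \<pi>(1) pG] subgroup.rcos_const[OF preimage_subgroup G.is_group]
      by (auto simp: act.closed_words_def)
    then have "card {w \<in> lists (signed_alphabet A). length w = n \<and> word_value G \<pi> w \<in> preimage} \<le>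
        card (act.closed_words n preimage)"
      by (rule card_mono[OF act.finite_closed_words])
    then show "real (card {w \<in> lists (signed_alphabet A). length w = n \<and> word_value G \<pi> w \<in> preimage})
        \<le> act.\<rho> ^ n"
      using act.card_closed_words[of n] by linarith
  qed (rule act.\<rho>_bounds)+
qed

end

section \<open>Averaging over length-invariant measures\<close>

text \<open>A convergent sequence is bounded, so one constant serves all lengths and not only large
  ones.\<close>

lemma subexponential_bound:
  assumes "subexponential g" "1 < s"
  obtains D :: real where "0 < D" "\<And>n. real (g n) \<le> D * s ^ n"
proof -
  have "(\<lambda>n. real (g n) / s ^ n) \<longlonglongrightarrow> 0" using assms by (auto simp: subexponential_def)
  then have "Bseq (\<lambda>n. real (g n) / s ^ n)" by (intro convergent_imp_Bseq convergentI)
  then obtain D where D: "0 < D" "\<And>n. norm (real (g n) / s ^ n) \<le> D" by (auto elim: BseqE)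
  have "real (g n) \<le> D * s ^ n" for n
    using D(2)[of n] assms(2) by (simp add: pos_divide_le_eq)
  then show thesis using that D(1) by blast
qed

text \<open>
  A length-invariant measure gives each word of length \<open>n\<close> at most \<open>1 / card X ^ n\<close> of the mass of
  its length, so an exponentially small set of words can afford an exponential cost.
\<close>

lemma average_bound:
  fixes q :: "'x list \<Rightarrow> real"
  assumes X: "finite X" and r: "0 < r" "r < real (card X)" and D: "0 \<le> D"
    and few: "\<And>n. real (card {w \<in> lists X. length w = n \<and> w \<in> P}) \<le> r ^ n"
    and q: "\<And>w. w \<in> lists X \<Longrightarrow> 0 \<le> q w \<and>
      q w \<le> 1 + (if w \<in> P then D * (real (card X) / r) ^ length w else 0)"
    and \<mu>: "discrete_probability_measure X \<mu>" "length_invariant X \<mu>"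
  shows "(\<lambda>w. q w * \<mu> w) summable_on lists X \<and> (\<Sum>\<^sub>\<infinity>w\<in>lists X. q w * \<mu> w) \<le> 1 + D"
proof -
  let ?d = "real (card X)"
  have \<mu>_nonneg: "0 \<le> \<mu> w" if "w \<in> lists X" for w
    using \<mu>(1) that by (auto simp: discrete_probability_measure_def)
  have mass: "(\<Sum>w\<in>W. \<mu> w) \<le> 1" if "finite W" "W \<subseteq> lists X" for W
  proof (rule finite_sum_le_has_sum)
    show "(\<mu> has_sum 1) (lists X)" using \<mu>(1) unfolding discrete_probability_measure_def by blast
  qed (use that \<mu>_nonneg in auto)
  obtain x where x: "x \<in> X" using r by (cases "X = {}") auto
  define m where "m n = \<mu> (replicate n x)" for n
  have m: "\<mu> w = m (length w)" if "w \<in> lists X" for w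
  proof -
    have "replicate (length w) x \<in> lists X" using x by auto
    from \<mu>(2)[unfolded length_invariant_def, rule_format, OF that this] show ?thesis
      by (simp add: m_def)
  qed
  have m_nonneg: "0 \<le> m n" for n
    unfolding m_def by (rule \<mu>_nonneg) (use x in auto)
  \<comment> \<open>The terms are nonnegative, so a common bound on finite partial sums yields both
    summability and the bound on the infinite sum.\<close>
  have part: "(\<Sum>w\<in>W. q w * \<mu> w) \<le> 1 + D" if W: "finite W" "W \<subseteq> lists X" for W
  proof -
    define N where "N = Max (length ` W)"
    have N: "length w \<le> N" if "w \<in> W" for w
      unfolding N_def using W(1) that by simp
    define L where "L n = {w \<in> lists X. length w = n}" for n
    have finL: "finite (L n)" for n
      using finite_lists_length_eq[OF X, of n] by (simp add: L_def lists_eq_set conj_commute)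
    have cardL: "real (card (L n)) = ?d ^ n" for n
      using card_lists_length_eq[OF X, of n] by (simp add: L_def lists_eq_set conj_commute)
    have "(\<Sum>w\<in>W. q w * \<mu> w) \<le> (\<Sum>w\<in>W. \<mu> w + (if w \<in> P then D * (?d / r) ^ length w * m (length w) else 0))"
    proof (rule sum_mono)
      fix w assume "w \<in> W"
      then have w: "w \<in> lists X" using W by blast
      have "q w * \<mu> w \<le> (1 + (if w \<in> P then D * (?d / r) ^ length w else 0)) * \<mu> w"
        using q[OF w] \<mu>_nonneg[OF w] by (intro mult_right_mono) auto
      then show "q w * \<mu> w \<le> \<mu> w + (if w \<in> P then D * (?d / r) ^ length w * m (length w) else 0)"
        by (auto simp: distrib_right m[OF w])
    qed
    also have "\<dots> = (\<Sum>w\<in>W. \<mu> w) + (\<Sum>w\<in>W \<inter> P. D * (?d / r) ^ length w * m (length w))"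
      using W(1) by (simp add: sum.distrib sum.If_cases Int_def)
    \<comment> \<open>\<open>W\<close> is enlarged to full spheres up to its greatest length, where
      the counting hypothesis applies.\<close>
    also have "(\<Sum>w\<in>W \<inter> P. D * (?d / r) ^ length w * m (length w)) \<le>
        (\<Sum>w\<in>(\<Union>n\<le>N. L n \<inter> P). D * (?d / r) ^ length w * m (length w))"
      using W N finL D r m_nonneg by (intro sum_mono2) (auto simp: L_def)
    also have "\<dots> = (\<Sum>n\<le>N. \<Sum>w\<in>L n \<inter> P. D * (?d / r) ^ length w * m (length w))"
      using finL by (intro sum.UNION_disjoint) (auto simp: L_def)
    also have "\<dots> = (\<Sum>n\<le>N. real (card (L n \<inter> P)) * (D * (?d / r) ^ n * m n))"
      by (intro sum.cong HOL.refl) (simp add: L_def)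
    also have "\<dots> \<le> (\<Sum>n\<le>N. r ^ n * (D * (?d / r) ^ n * m n))"
    proof (intro sum_mono mult_right_mono)
      fix n
      have "L n \<inter> P = {w \<in> lists X. length w = n \<and> w \<in> P}" by (auto simp: L_def)
      then show "real (card (L n \<inter> P)) \<le> r ^ n" using few by simp
      show "0 \<le> D * (?d / r) ^ n * m n" using D r m_nonneg by simp
    qed
    \<comment> \<open>Here \<open>r ^ n\<close> cancels against the denominator of the cost, and the
      remaining \<open>card X ^ n * m n\<close> is exactly the mass of the words of length
      n.\<close>
    also have "\<dots> = D * (\<Sum>n\<le>N. \<Sum>w\<in>L n. \<mu> w)"
    proof -
      have "(\<Sum>w\<in>L n. \<mu> w) = ?d ^ n * m n" for n
      proof -
        have "(\<Sum>w\<in>L n. \<mu> w) = (\<Sum>w\<in>L n. m n)" by (intro sum.cong HOL.refl) (auto simp: L_def m)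
        then show ?thesis by (simp add: cardL)
      qed
      then show ?thesis using r by (simp add: sum_distrib_left power_divide mult_ac)
    qed
    also have "(\<Sum>n\<le>N. \<Sum>w\<in>L n. \<mu> w) = (\<Sum>w\<in>(\<Union>n\<le>N. L n). \<mu> w)"
      using finL by (intro sum.UNION_disjoint[symmetric]) (auto simp: L_def)
    also have "D * \<dots> \<le> D * 1"
      using finL D by (intro mult_left_mono mass) (auto simp: L_def)
    finally show ?thesis using mass[OF W] by simp
  qed
  have nonneg: "0 \<le> q w * \<mu> w" if "w \<in> lists X" for w
    using q \<mu>_nonneg that by simp
  have "(\<lambda>w. q w * \<mu> w) summable_on lists X"
    using part nonneg by (intro nonneg_bdd_above_summable_on bdd_aboveI[of _ "1 + D"]) auto
  moreover from this have "(\<Sum>\<^sub>\<infinity>w\<in>lists X. q w * \<mu> w) \<le> 1 + D"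
    using part by (intro infsum_le_finite_sums) auto
  ultimately show ?thesis by blast
qed

section \<open>Solving the membership problem on average\<close>

context finite_index_epi
begin

text \<open>Left cosets are needed because reading from right to left multiplies on the left.
  Inverting a right transversal gives them; its members in \<open>G1\<close> are replaced by the
  identity, so that the state of the transducer reveals whether the value lies in
  \<open>G1\<close>.\<close>

lemma left_transversal:
  obtains R where "finite R" "R \<subseteq> carrier G" "R \<inter> G1 = {\<one>}"
    "\<And>g. g \<in> carrier G \<Longrightarrow> \<exists>s \<in> R. inv s \<otimes> g \<in> G1"
proof -
  obtain T where T: "finite T" "T \<subseteq> carrier G" "\<And>g. g \<in> carrier G \<Longrightarrow> \<exists>t \<in> T. g \<otimes> inv t \<in> G1"
    using transversal by blast
  define R where "R = insert \<one> ((\<lambda>t. inv t) ` T - G1)"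
  show thesis
  proof (rule that[of R])
    fix g assume g: "g \<in> carrier G"
    show "\<exists>s \<in> R. inv s \<otimes> g \<in> G1"
    proof (cases "g \<in> G1")
      case True
      then show ?thesis using g by (auto simp: R_def)
    next
      case False
      obtain t where t: "t \<in> T" "inv g \<otimes> inv t \<in> G1" using T(3)[of "inv g"] g by auto
      then have tG: "t \<in> carrier G" using T(2) by blast
      have *: "t \<otimes> g \<in> G1" using G1_closed(3)[OF t(2)] g tG by (simp add: G.inv_mult_group)
      have "inv t \<notin> G1"
      proof
        assume "inv t \<in> G1"
        from G1_closed(2)[OF this *] show False using False g tG by (simp add: G.cancel_left)
      qed
      then show ?thesis using t(1) * tG by (intro bexI[of _ "inv t"]) (auto simp: R_def)
    qed
  qed (use T in \<open>auto simp: R_def\<close>)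
qed

text \<open>Reidemeister-Schreier rewriting. After the suffix with value g the state is the
  representative s of g G1, and the first output spells \<phi>(s^-1 g). Reading x replaces s by s'
  and contributes the factor s'^-1 x s, an element of \<open>G1\<close>. The second output spells g
  itself in the generators for which \<open>N'\<close> is given.\<close>

theorem deciding_machine:
  fixes B B' :: "'b::countable set"
  assumes A: "generating_alphabet G A \<pi>"
    and B: "generating_alphabet G' B \<tau>" and N: "decides N (signed_alphabet B) (snd (MP G' K B \<tau>))"
    and B': "generating_alphabet G B' \<tau>'" and N': "decides N' (signed_alphabet B') (snd (MP G H B' \<tau>'))"
    and H: "H \<subseteq> preimage"
  obtains M b where "decides M (signed_alphabet A) (snd (MP G H A \<pi>))"
    "\<And>w. w \<in> lists (signed_alphabet A) \<Longrightarrow>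
      \<exists>v \<in> lists (signed_alphabet B). \<exists>v' \<in> lists (signed_alphabet B').
        length v \<le> b * length w \<and> length v' \<le> b * length w \<and>
        run_time M w \<le> (b + 2) * length w + 3 + run_time N v +
          (if word_value G \<pi> w \<in> preimage then run_time N' v' + 1 else 0)"
proof -
  let ?X = "signed_alphabet A" and ?B = "signed_alphabet B" and ?B' = "signed_alphabet B'"
  have \<pi>: "\<pi> ` A \<subseteq> carrier G" "finite A" and \<tau>: "\<tau> ` B \<subseteq> carrier G'" and \<tau>': "\<tau>' ` B' \<subseteq> carrier G"
    using A B B' by (auto simp: generating_alphabet_def)
  obtain R where R: "finite R" "R \<subseteq> carrier G" "R \<inter> G1 = {\<one>}"
    "\<And>g. g \<in> carrier G \<Longrightarrow> \<exists>s \<in> R. inv s \<otimes> g \<in> G1"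
    using left_transversal by blast
  have RG: "s \<in> carrier G" if "s \<in> R" for s using R(2) that by blast
  have XG: "letter_value G \<pi> x \<in> carrier G" if "x \<in> ?X" for x
    using G.letter_value_closed[OF \<pi>(1) that] .
  have "\<forall>g \<in> carrier G. \<exists>s. s \<in> R \<and> inv s \<otimes> g \<in> G1" using R(4) by blast
  from bchoice[OF this] obtain r where r: "\<And>g. g \<in> carrier G \<Longrightarrow> r g \<in> R \<and> inv (r g) \<otimes> g \<in> G1"
    by blast
  obtain e :: "'g \<Rightarrow> nat" where e: "inj_on e R"
    using finite_imp_inj_to_nat_seg[OF R(1)] by blast
  define dec where "dec = inv_into R e"
  have dec_e: "dec (e s) = s" if "s \<in> R" for s
    using inv_into_f_f[OF e that] by (simp add: dec_def)
  \<comment> \<open>The Schreier generators s'^-1 x s, with s' the representative of x s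
    \<open>G1\<close>.\<close>
  define k where "k s x = inv (r (letter_value G \<pi> x \<otimes> s)) \<otimes> (letter_value G \<pi> x \<otimes> s)" for s x
  have k: "k s x \<in> G1" if "s \<in> R" "x \<in> ?X" for s x
    unfolding k_def using r[of "letter_value G \<pi> x \<otimes> s"] RG[OF that(1)] XG[OF that(2)] by simp
  have ex_out: "\<exists>v. v \<in> lists ?B \<and> word_value G' \<tau> v = \<phi> (k (fst p) (snd p))" if "p \<in> R \<times> ?X" for p
  proof -
    have "\<phi> (k (fst p) (snd p)) \<in> carrier G'" using \<phi>_in k that by auto
    from G'.generated_by_words[OF B this] show ?thesis by blast
  qed
  define out where
    "out p = (SOME v. v \<in> lists ?B \<and> word_value G' \<tau> v = \<phi> (k (fst p) (snd p)))" for p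
  have out_spec: "out (s, x) \<in> lists ?B" "word_value G' \<tau> (out (s, x)) = \<phi> (k s x)"
    if "s \<in> R" "x \<in> ?X" for s x
    using someI_ex[OF ex_out[of "(s, x)"]] that unfolding out_def by simp_all
  have ex_out': "\<exists>v. v \<in> lists ?B' \<and> word_value G \<tau>' v = letter_value G \<pi> x" if "x \<in> ?X" for x
    using G.generated_by_words[OF B' XG[OF that]] by blast
  define out' where
    "out' x = (SOME v. v \<in> lists ?B' \<and> word_value G \<tau>' v = letter_value G \<pi> x)" for x
  have out'_spec: "out' x \<in> lists ?B' \<and> word_value G \<tau>' (out' x) = letter_value G \<pi> x" if "x \<in> ?X" for x
    unfolding out'_def by (rule someI_ex[OF ex_out'[OF that]])
  \<comment> \<open>A sum over finitely many blocks, used as an upper bound for their maximal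
    length.\<close>
  define b where "b = (\<Sum>p\<in>R \<times> ?X. length (out p)) + (\<Sum>x\<in>?X. length (out' x))"
  have finX: "finite ?X" using finite_signed_alphabet[OF \<pi>(2)] .
  have b: "length (out (s, x)) \<le> b" "length (out' x) \<le> b" if "s \<in> R" "x \<in> ?X" for s x
  proof -
    have "length (out (s, x)) \<le> (\<Sum>p\<in>R \<times> ?X. length (out p))"
      using that R(1) finX by (intro member_le_sum) auto
    then show "length (out (s, x)) \<le> b" by (simp add: b_def)
    have "length (out' x) \<le> (\<Sum>x\<in>?X. length (out' x))"
      using that finX by (intro member_le_sum) auto
    then show "length (out' x) \<le> b" by (simp add: b_def)
  qed
  have one: "\<one> \<in> R" using R(3) by blast
  interpret two_stage ?X ?B ?B' N N' "snd (MP G' K B \<tau>)" "snd (MP G H B' \<tau>')" "e ` R" "e \<one>"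
    "\<lambda>q x. e (r (letter_value G \<pi> x \<otimes> dec q))" "\<lambda>q x. out (dec q, x)" "\<lambda>q x. out' x" b
  proof
    fix q x assume q: "q \<in> e ` R" and x: "x \<in> ?X"
    then obtain s where s: "q = e s" "s \<in> R" by blast
    show "e (r (letter_value G \<pi> x \<otimes> dec q)) \<in> e ` R"
      using r[of "letter_value G \<pi> x \<otimes> s"] RG[OF s(2)] XG[OF x] by (simp add: s dec_e)
    show "out (dec q, x) \<in> lists ?B \<and> length (out (dec q, x)) \<le> b"
      using out_spec(1)[OF s(2) x] b(1)[OF s(2) x] by (simp add: s dec_e)
    show "out' x \<in> lists ?B' \<and> length (out' x) \<le> b"
      using out'_spec b(2)[OF s(2) x] x by blast
  qed (use finX N N' R(1) one in auto)
  have inv: "dec (state w) \<in> R \<and> state w = e (dec (state w)) \<and> inv (dec (state w)) \<otimes> word_value G \<pi> w \<in> G1 \<and>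
      word_value G' \<tau> (emitted w) = \<phi> (inv (dec (state w)) \<otimes> word_value G \<pi> w) \<and>
      word_value G \<tau>' (emitted' w) = word_value G \<pi> w"
    if "w \<in> lists ?X" for w
    using that
  proof (induction w rule: list.induct)
    case Nil
    then show ?case using one \<phi>_one by (simp add: dec_e)
  next
    case (Cons x w)
    then have x: "x \<in> ?X" and w: "w \<in> lists ?X" by auto
    define s where "s = dec (state w)"
    define g where "g = word_value G \<pi> w"
    define a where "a = letter_value G \<pi> x"
    have IH: "s \<in> R" "inv s \<otimes> g \<in> G1" "word_value G' \<tau> (emitted w) = \<phi> (inv s \<otimes> g)"
      "word_value G \<tau>' (emitted' w) = g"
      using Cons.IH[OF w] by (auto simp: s_def g_def)
    have a: "a \<in> carrier G" and g: "g \<in> carrier G" and s: "s \<in> carrier G"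
      using XG[OF x] G.word_value_closed[OF \<pi>(1) w] RG[OF IH(1)] by (auto simp: a_def g_def)
    define s' where "s' = r (a \<otimes> s)"
    have s': "s' \<in> R" using r a s by (simp add: s'_def)
    have k_eq: "k s x = inv s' \<otimes> (a \<otimes> s)" by (simp add: k_def s'_def a_def)
    have prod: "k s x \<otimes> (inv s \<otimes> g) = inv s' \<otimes> (a \<otimes> g)"
      unfolding k_eq using a g s RG[OF s'] by (simp add: G.m_assoc G.cancel_left)
    have st: "dec (state (x # w)) = s'" "state (x # w) = e s'"
      using dec_e[OF s'] by (simp_all add: s'_def s_def a_def)
    have "inv s' \<otimes> (a \<otimes> g) \<in> G1"
      unfolding prod[symmetric] using k[OF IH(1) x] IH(2) by simp
    moreover have "word_value G' \<tau> (emitted (x # w)) = \<phi> (inv s' \<otimes> (a \<otimes> g))"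
    proof -
      have "word_value G' \<tau> (emitted (x # w)) =
          word_value G' \<tau> (out (s, x)) \<otimes>\<^bsub>G'\<^esub> word_value G' \<tau> (emitted w)"
        using G'.word_value_append[OF \<tau> out_spec(1)[OF IH(1) x] conjunct1[OF emitted_in[OF w]]]
        by (simp add: s_def)
      then show ?thesis
        unfolding prod[symmetric] using out_spec(2)[OF IH(1) x] IH(2,3) k[OF IH(1) x] by (simp add: \<phi>_mult)
    qed
    moreover have "word_value G \<tau>' (emitted' (x # w)) = a \<otimes> g"
    proof -
      have "out' x \<in> lists ?B'" using out'_spec x by blast
      from G.word_value_append[OF \<tau>' this conjunct1[OF emitted'_in[OF w]]]
      show ?thesis using out'_spec x IH(4) by (simp add: a_def)
    qed
    ultimately show ?case using st s' by (simp add: a_def g_def)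
  qed
  \<comment> \<open>The final state is the code of the identity exactly when the value g lies in
    \<open>G1\<close>; in that case the first output spells \<phi>(g), which \<open>N\<close> tests
    for membership in \<open>K\<close>.\<close>
  have first_stage: "state w = e \<one> \<and> emitted w \<in> snd (MP G' K B \<tau>) \<longleftrightarrow> word_value G \<pi> w \<in> preimage"
    if w: "w \<in> lists ?X" for w
  proof -
    define s where "s = dec (state w)"
    define g where "g = word_value G \<pi> w"
    have g: "g \<in> carrier G" using G.word_value_closed[OF \<pi>(1) w] by (simp add: g_def)
    have s: "s \<in> R" "state w = e s" "inv s \<otimes> g \<in> G1" "word_value G' \<tau> (emitted w) = \<phi> (inv s \<otimes> g)"
      using inv[OF w] by (auto simp: s_def g_def)
    note sG = RG[OF s(1)]
    have "state w = e \<one> \<longleftrightarrow> s = \<one>" using inj_on_eq_iff[OF e s(1) one] s(2) by simp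
    also have "\<dots> \<longleftrightarrow> g \<in> G1"
    proof
      assume "s = \<one>"
      then show "g \<in> G1" using s(3) g by simp
    next
      assume gG: "g \<in> G1"
      have "g \<otimes> inv (inv s \<otimes> g) = s"
        using g sG by (simp add: G.inv_mult_group G.cancel_left)
      then have "s \<in> G1" using G1_closed(2)[OF gG G1_closed(3)[OF s(3)]] by simp
      then show "s = \<one>" using s(1) R(3) by blast
    qed
    finally have st: "state w = e \<one> \<longleftrightarrow> g \<in> G1" "state w = e \<one> \<longleftrightarrow> s = \<one>"
      using inj_on_eq_iff[OF e s(1) one] s(2) by auto
    have "emitted w \<in> snd (MP G' K B \<tau>) \<longleftrightarrow> \<phi> (inv s \<otimes> g) \<in> K"
      using emitted_in[OF w] s(4) by (simp add: MP_def)
    then show ?thesis using st g unfolding g_def[symmetric] by (auto simp: preimage_def)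
  qed
  have accept: "w \<in> accepted \<longleftrightarrow> w \<in> snd (MP G H A \<pi>)" if w: "w \<in> lists ?X" for w
  proof -
    have "emitted' w \<in> snd (MP G H B' \<tau>') \<longleftrightarrow> word_value G \<pi> w \<in> H"
      using emitted'_in[OF w] inv[OF w] by (simp add: MP_def)
    then have "w \<in> accepted \<longleftrightarrow> word_value G \<pi> w \<in> preimage \<and> word_value G \<pi> w \<in> H"
      using first_stage[OF w] unfolding accepted_def mem_Collect_eq by blast
    moreover have "w \<in> snd (MP G H A \<pi>) \<longleftrightarrow> word_value G \<pi> w \<in> H" using w by (simp add: MP_def)
    ultimately show ?thesis using H by blast
  qed
  show thesis
  proof (rule that[of combined b])
    show "decides combined ?X (snd (MP G H A \<pi>))"
      using combined_decides accept unfolding decides_def by blast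
    fix w assume w: "w \<in> lists ?X"
    show "\<exists>v \<in> lists ?B. \<exists>v' \<in> lists ?B'.
        length v \<le> b * length w \<and> length v' \<le> b * length w \<and>
        run_time combined w \<le> (b + 2) * length w + 3 + run_time N v +
          (if word_value G \<pi> w \<in> preimage then run_time N' v' + 1 else 0)"
      using combined_run_time[OF w] emitted_in[OF w] emitted'_in[OF w]
      unfolding first_stage[OF w] by blast
  qed
qed

end

theorem theoremC:
  fixes F :: "(nat \<Rightarrow> nat) set"
    and G :: "('g, 'm) monoid_scheme"
    and G' :: "('h, 'n) monoid_scheme"
    and H G1 :: "'g set" and K :: "'h set" and \<phi> :: "'g \<Rightarrow> 'h"
    and A :: "'a set" and \<pi> :: "'a \<Rightarrow> 'g"
  assumes "time_bounds F"
    and "time_class F \<subseteq> (SubExp :: nat problem set)"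
    and "group G" and "finitely_presented G"
    and "subgroup H G"
    and "membership_problem_in G H SubExp"
    and "subgroup G1 G" and "finite (rcosets\<^bsub>G\<^esub> G1)" and "H \<subseteq> G1"
    and "group G'" and "\<phi> \<in> epi (G\<lparr>carrier := G1\<rparr>) G'"
    and "subgroup K G'" and "\<phi> ` H \<subseteq> K"
    and "non_amenable_over G' K"
    and "membership_problem_in G' K (time_class F)"
    and "generating_alphabet G A \<pi>"
  shows "solvable_on_average (MP G H A \<pi>) F
    {\<mu>. discrete_probability_measure (signed_alphabet A) \<mu> \<and>
        length_invariant (signed_alphabet A) \<mu>}"
proof -
  interpret finite_index_epi G G' G1 K \<phi>
    using assms by (simp add: finite_index_epi_def finite_index_epi_axioms_def)
  let ?X = "signed_alphabet A"
  have finX: "finite ?X"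
    using assms(16) finite_signed_alphabet by (auto simp: generating_alphabet_def)
  have H: "H \<subseteq> preimage" using assms(9,13) by (auto simp: preimage_def)
  obtain B :: "nat set" and \<tau> N f where B: "generating_alphabet G' B \<tau>" and f: "f \<in> F"
    and N: "decides N (signed_alphabet B) (snd (MP G' K B \<tau>))"
      "\<And>v. v \<in> lists (signed_alphabet B) \<Longrightarrow> run_time N v \<le> f (length v)"
    using assms(15) by (auto simp: membership_problem_in_def time_class_def MP_def)
  obtain B' :: "nat set" and \<tau>' N' g where B': "generating_alphabet G B' \<tau>'" and g: "subexponential g"
    and N': "decides N' (signed_alphabet B') (snd (MP G H B' \<tau>'))"
      "\<And>v. v \<in> lists (signed_alphabet B') \<Longrightarrow> run_time N' v \<le> g (length v)"
    using assms(6) by (auto simp: membership_problem_in_def time_class_def MP_def SubExp_def)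
  obtain M b where M: "decides M ?X (snd (MP G H A \<pi>))"
    and time: "\<And>w. w \<in> lists ?X \<Longrightarrow>
      \<exists>v \<in> lists (signed_alphabet B). \<exists>v' \<in> lists (signed_alphabet B').
        length v \<le> b * length w \<and> length v' \<le> b * length w \<and>
        run_time M w \<le> (b + 2) * length w + 3 + run_time N v +
          (if word_value G \<pi> w \<in> preimage then run_time N' v' + 1 else 0)"
    using deciding_machine[OF assms(16) B N(1) B' N'(1) H] by blast
  obtain r where r: "0 < r" "r < real (card ?X)"
    and few: "\<And>n. real (card {w \<in> lists ?X. length w = n \<and> word_value G \<pi> w \<in> preimage}) \<le> r ^ n"
    using exponentially_few[OF assms(14,16)] by blast
  define ratio where "ratio = real (card ?X) / r"
  have ratio: "1 < ratio" using r by (simp add: ratio_def)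
  \<comment> \<open>The input of \<open>N'\<close> may have length \<open>b * n\<close>, so its cost
    is controlled by \<open>s ^ (b * n)\<close>, at most \<open>ratio ^ n\<close>.
    \<open>Suc b\<close> keeps the root meaningful when \<open>b = 0\<close>.\<close>
  define s where "s = root (Suc b) ratio"
  have s: "1 < s" "s ^ Suc b = ratio"
    using ratio by (simp_all add: s_def real_root_pow_pos2 del: power_Suc)
  obtain D where D: "0 < D" "\<And>n. real (g n) \<le> D * s ^ n"
    using subexponential_bound[OF g s(1)] by blast
  \<comment> \<open>With y = f (C n + C), the first stage costs at most (b + 2) y + 3 + y, which
    \<open>C * y + C\<close> dominates. The closure property of \<open>F\<close> then admits this
    bound.\<close>
  define C where "C = b + 5"
  define f' where "f' n = C * f (C * n + C) + C" for n
  have mono_f: "mono f" and f_ge: "\<And>n. n \<le> f n" and f': "f' \<in> F"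
    using assms(1) f unfolding time_bounds_def proper_complexity_function_def f'_def
    by (auto simp: C_def)
  have mono_f': "mono f'"
    unfolding f'_def by (intro monoI add_mono mult_le_mono order_refl monoD[OF mono_f]) auto
  have f'_pos: "1 \<le> f' n" for n by (simp add: f'_def C_def)
  \<comment> \<open>Outside the preimage the quotient is at most 1. Inside it the second stage adds
    its own cost, divided by \<open>f'\<close>, which is at least 1; \<open>D + 1\<close> also
    covers the final step.\<close>
  have cost: "real (run_time M w) / real (f' (length w)) \<le>
      1 + (if w \<in> {w. word_value G \<pi> w \<in> preimage} then (D + 1) * ratio ^ length w else 0)"
    if w: "w \<in> lists ?X" for w
  proof -
    let ?n = "length w"
    obtain v v' where v: "v \<in> lists (signed_alphabet B)" "v' \<in> lists (signed_alphabet B')"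
      "length v \<le> b * ?n" "length v' \<le> b * ?n"
      "run_time M w \<le> (b + 2) * ?n + 3 + run_time N v +
          (if word_value G \<pi> w \<in> preimage then run_time N' v' + 1 else 0)"
      using time[OF w] by blast
    define y where "y = f (C * ?n + C)"
    have "length v \<le> C * ?n + C" using v(3) by (simp add: C_def algebra_simps)
    then have "run_time N v \<le> y"
      using N(2)[OF v(1)] monoD[OF mono_f, of "length v" "C * ?n + C"] by (simp add: y_def)
    moreover have "?n \<le> y" using f_ge[of "C * ?n + C"] by (simp add: y_def C_def algebra_simps)
    then have "(b + 2) * ?n \<le> (b + 2) * y" by (rule mult_le_mono2)
    ultimately have "(b + 2) * ?n + 3 + run_time N v \<le> f' ?n"
      by (simp add: f'_def y_def[symmetric]) (simp add: C_def algebra_simps)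
    then have T: "real (run_time M w) \<le> real (f' ?n) +
        (if word_value G \<pi> w \<in> preimage then real (run_time N' v') + 1 else 0)"
      using v(5) by (auto split: if_splits)
    have "real (run_time N' v') \<le> D * s ^ length v'"
      using N'(2)[OF v(2)] D(2)[of "length v'"] by linarith
    also have "\<dots> \<le> D * s ^ (Suc b * ?n)"
      using v(4) s(1) D(1) by (intro mult_left_mono power_increasing) auto
    also have "\<dots> = D * ratio ^ ?n" unfolding power_mult s(2) ..
    finally have T': "real (run_time N' v') + 1 \<le> (D + 1) * ratio ^ ?n"
      using one_le_power[of ratio ?n] ratio unfolding distrib_right by linarith
    have "real (run_time M w) / real (f' ?n) \<le> (real (f' ?n) +
        (if word_value G \<pi> w \<in> preimage then real (run_time N' v') + 1 else 0)) / real (f' ?n)"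
      using T by (rule divide_right_mono) simp
    also have "\<dots> = 1 + (if word_value G \<pi> w \<in> preimage then real (run_time N' v') + 1 else 0) / real (f' ?n)"
      using f'_pos[of ?n] by (simp add: add_divide_distrib)
    also have "\<dots> \<le> 1 + (if word_value G \<pi> w \<in> preimage then real (run_time N' v') + 1 else 0) / 1"
      using f'_pos[of ?n] by (intro add_left_mono divide_left_mono) auto
    finally show ?thesis using T' by (auto split: if_splits)
  qed
  have "solves_on_average M (MP G H A \<pi>) (\<lambda>n. real (f' n))
    {\<mu>. discrete_probability_measure ?X \<mu> \<and> length_invariant ?X \<mu>}"
    unfolding solves_on_average_def
  proof (intro conjI exI[of _ "1 + (D + 1)"] ballI allI)
    show "decides M (fst (MP G H A \<pi>)) (snd (MP G H A \<pi>))" using M by (simp add: MP_def)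
    show "mono (\<lambda>n. real (f' n))" using mono_f' by (auto simp: mono_def)
    show "0 < real (f' n)" for n using f'_pos[of n] by simp
    show "0 < 1 + (D + 1)" using D(1) by simp
    fix \<mu> assume "\<mu> \<in> {\<mu>. discrete_probability_measure ?X \<mu> \<and> length_invariant ?X \<mu>}"
    then have \<mu>: "discrete_probability_measure ?X \<mu>" "length_invariant ?X \<mu>" by blast+
    have "(\<lambda>w. real (run_time M w) / real (f' (length w)) * \<mu> w) summable_on lists ?X \<and>
      (\<Sum>\<^sub>\<infinity>w\<in>lists ?X. real (run_time M w) / real (f' (length w)) * \<mu> w) \<le> 1 + (D + 1)"
    proof (rule average_bound[OF finX r, where P = "{w. word_value G \<pi> w \<in> preimage}"])
      show "0 \<le> D + 1" using D(1) by simp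
      show "real (card {w \<in> lists ?X. length w = n \<and> w \<in> {w. word_value G \<pi> w \<in> preimage}}) \<le> r ^ n"
        for n using few[of n] by simp
    qed (use \<mu> cost in \<open>simp_all only: flip: ratio_def, simp\<close>)
    then show "(\<lambda>w. real (run_time M w) / real (f' (length w)) * \<mu> w) summable_on lists (fst (MP G H A \<pi>))"
      "(\<Sum>\<^sub>\<infinity>w\<in>lists (fst (MP G H A \<pi>)). real (run_time M w) / real (f' (length w)) * \<mu> w) \<le> 1 + (D + 1)"
      by (simp_all add: MP_def)
  qed
  then show ?thesis using f' unfolding solvable_on_average_def by blast
qed

end
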